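(* Let $m\in\mathbb{N}$ and let $\mathcal{C}=\mathcal{C}^{\perp}\leq \mathbb{F}_2^{24m}$ be an extremal binary self-dual code of length $24m$. Let $\sigma\in\mathrm{Aut}(\mathcal{C})$ be a fixed point free automorphism of order $2$. If $m$ is odd, or if $m=2\mu$ with $\binom{5\mu-1}{\mu-1}$ odd, then $\mathcal{C}$ is a free $\mathbb{F}_2\langle\sigma\rangle$-module.
   Context: A binary self-dual code $\mathcal{C}=\mathcal{C}^\perp\leq\mathbb{F}_2^{24m}$ (orthogonality with respect to the standard inner product) is called extremal if its minimum distance is $d(\mathcal{C})=4m+4$. $\mathrm{Aut}(\mathcal{C})=\{\sigma\in S_{24m}\mid \sigma(\mathcal{C})=\mathcal{C}\}$ is the group of coordinate permutations preserving $\mathcal{C}$; $\sigma$ is fixed point free if it fixes no coordinate. $\mathcal{C}$ is regarded as a module over the group algebra $\mathbb{F}_2\langle\sigma\rangle$ via the permutation action. *)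

theory Defs
  imports "HOL-Library.Z2" "HOL-Combinatorics.Permutations" "HOL-Library.FuncSet"
begin

definition vecs :: "nat \<Rightarrow> (nat \<Rightarrow> bit) set" where
  "vecs n = {x. \<forall>i\<ge>n. x i = 0}"

definition inner :: "nat \<Rightarrow> (nat \<Rightarrow> bit) \<Rightarrow> (nat \<Rightarrow> bit) \<Rightarrow> bit" where
  "inner n x y = (\<Sum>i<n. x i * y i)"

definition linear_code :: "nat \<Rightarrow> (nat \<Rightarrow> bit) set \<Rightarrow> bool" where
  "linear_code n C \<longleftrightarrow> C \<subseteq> vecs n \<and> (\<lambda>_. 0) \<in> C \<and> (\<forall>x\<in>C. \<forall>y\<in>C. (\<lambda>i. x i + y i) \<in> C)"

definition dual_code :: "nat \<Rightarrow> (nat \<Rightarrow> bit) set \<Rightarrow> (nat \<Rightarrow> bit) set" where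
  "dual_code n C = {y \<in> vecs n. \<forall>x\<in>C. inner n x y = 0}"

definition self_dual :: "nat \<Rightarrow> (nat \<Rightarrow> bit) set \<Rightarrow> bool" where
  "self_dual n C \<longleftrightarrow> linear_code n C \<and> C = dual_code n C"

definition weight :: "nat \<Rightarrow> (nat \<Rightarrow> bit) \<Rightarrow> nat" where
  "weight n x = card {i. i < n \<and> x i \<noteq> 0}"

definition min_dist :: "nat \<Rightarrow> (nat \<Rightarrow> bit) set \<Rightarrow> nat" where
  "min_dist n C = Min (weight n ` (C - {\<lambda>_. 0}))"

definition extremal :: "nat \<Rightarrow> (nat \<Rightarrow> bit) set \<Rightarrow> bool" where
  "extremal m C \<longleftrightarrow> self_dual (24 * m) C \<and> min_dist (24 * m) C = 4 * m + 4"

definition perm_vec :: "(nat \<Rightarrow> nat) \<Rightarrow> (nat \<Rightarrow> bit) \<Rightarrow> (nat \<Rightarrow> bit)" where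
  "perm_vec \<sigma> x = x \<circ> inv \<sigma>"

definition is_aut :: "nat \<Rightarrow> (nat \<Rightarrow> bit) set \<Rightarrow> (nat \<Rightarrow> nat) \<Rightarrow> bool" where
  "is_aut n C \<sigma> \<longleftrightarrow> \<sigma> permutes {0..<n} \<and> perm_vec \<sigma> ` C = C"

text \<open>Group algebra F_2<sigma> for sigma of order 2: element (a0,a1) = a0 + a1 sigma,
  acting on vectors by a0 x + a1 sigma(x).\<close>
definition galg_act :: "(nat \<Rightarrow> nat) \<Rightarrow> bit \<times> bit \<Rightarrow> (nat \<Rightarrow> bit) \<Rightarrow> (nat \<Rightarrow> bit)" where
  "galg_act \<sigma> a x = (\<lambda>i. fst a * x i + snd a * perm_vec \<sigma> x i)"

definition free_galg_module :: "(nat \<Rightarrow> nat) \<Rightarrow> (nat \<Rightarrow> bit) set \<Rightarrow> bool" where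
  "free_galg_module \<sigma> C \<longleftrightarrow>
     (\<exists>B. finite B \<and> B \<subseteq> C \<and>
        (\<forall>c\<in>C. \<exists>!coef. coef \<in> B \<rightarrow>\<^sub>E UNIV \<and>
                  c = (\<lambda>i. \<Sum>b\<in>B. galg_act \<sigma> (coef b) b i)))"

end

theory Submission
  imports Defs Complex_Main "HOL-Computational_Algebra.Polynomial_FPS" "HOL-Computational_Algebra.Primes"
begin

text \<open>
  Let \<open>T\<close> be a set of representatives of the \<open>12m\<close> orbits of \<open>\<sigma>\<close>, let \<open>E\<close> be the image of
  \<open>(1 + \<sigma>)C\<close> and \<open>B\<close> the image of the fixed code of \<open>\<sigma>\<close> in \<open>F\<^sub>2\<^sup>T\<close>. Then \<open>B\<close> is the dual of \<open>E\<close>,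
  it contains \<open>E\<close>, its minimum distance is at least \<open>2m + 2\<close>, and \<open>C\<close> is free as soon as \<open>E = B\<close>.

  Extremality forces \<open>C\<close> to be doubly even (Rains): by Gleason's theorem the weight enumerator
  of \<open>C\<close> is a polynomial in two basic invariants, and Lagrange inversion turns the vanishing of the
  coefficients below \<open>4m + 4\<close> into two linear relations between the numbers of vectors of
  weight \<open>4l\<close> in the shadow; together they leave room only for the zero vector. So all
  weights in \<open>B\<close> are even.

  If \<open>E \<noteq> B\<close>, put \<open>\<kappa> = 2\<^sup>6\<^sup>m / |E|\<close>, an even number. Then \<open>W\<^sub>B - \<kappa> W\<^sub>E\<close> changes sign under the
  MacWilliams transform, so it is \<open>x\<^sup>4 - 6x\<^sup>2y\<^sup>2 + y\<^sup>4\<close> times a polynomial in the same basic invariants,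
  and its shadow transform counts, up to a factor, the shadow vectors of \<open>E\<close> of weight congruent
  to \<open>6m + 2\<close> modulo 4. Lagrange inversion now expresses a nonnegative integer combination of these
  counts as \<open>(-1)\<^sup>m (\<kappa> - 1) G / 4\<close> with \<open>G > 0\<close>: negative if \<open>m\<close> is odd, and not an integer if
  \<open>m = 2\<mu>\<close>, where \<open>G\<close> is 6 times the given odd binomial coefficient.
\<close>

subsection \<open>Gleason's theorem\<close>

text \<open>A nonzero polynomial has finitely many roots, and the complex numbers are infinite. This
  turns functional equations known only away from poles and exceptional points into identities of
  coefficients.\<close>

lemma poly_eqI_cofinite:
  fixes p q :: "complex poly"
  assumes "finite S" "\<And>y. y \<notin> S \<Longrightarrow> poly p y = poly q y"
  shows "p = q"
proof (rule ccontr)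
  assume "p \<noteq> q"
  then have "finite {y. poly (p - q) y = 0}" by (intro poly_roots_finite) simp
  moreover have "UNIV - S \<subseteq> {y. poly (p - q) y = 0}" using assms(2) by auto
  ultimately have "finite (UNIV - S)" using finite_subset by blast
  then have "finite (UNIV :: complex set)" using assms(1) by (simp add: finite_Diff2)
  then show False by (simp add: infinite_UNIV_char_0)
qed

text \<open>For the inhomogeneous polynomial \<open>p(y) = W(1, y)\<close> of degree at most \<open>2H\<close>, the condition says that \<open>W\<close> is
  even and that the substitution \<open>(x, y) \<mapsto> (x + y, x - y) / \<surd>2\<close> multiplies it by \<open>\<epsilon>\<close>. The
  exceptional points are excluded so that the condition passes to quotients by
  \<open>y\<^sup>2 (1 - y\<^sup>2)\<^sup>2\<close>.\<close>

definition tau_inv :: "complex \<Rightarrow> nat \<Rightarrow> complex poly \<Rightarrow> bool" where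
  "tau_inv \<epsilon> H p \<longleftrightarrow> degree p \<le> 2 * H \<and> pcompose p [:0, -1:] = p \<and>
     (\<forall>y. y \<notin> {0, 1, -1} \<longrightarrow> (1 + y) ^ (2 * H) * poly p ((1 - y) / (1 + y)) = \<epsilon> * 2 ^ H * poly p y)"

lemma poly_altdef_le: "degree (p :: 'a::comm_semiring_1 poly) \<le> N \<Longrightarrow> poly p x = (\<Sum>k\<le>N. coeff p k * x ^ k)"
  unfolding poly_altdef by (rule sum.mono_neutral_left) (auto simp: coeff_eq_0)

lemma homogenize_poly:
  fixes p :: "'a::field poly"
  assumes "degree p \<le> N" "x \<noteq> 0"
  shows "(\<Sum>k\<le>N. coeff p k * (x ^ (N - k) * y ^ k)) = x ^ N * poly p (y / x)"
proof -
  have "poly p (y / x) = (\<Sum>k\<le>N. coeff p k * (y / x) ^ k)"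
    by (rule poly_altdef_le[OF assms(1)])
  then have "x ^ N * poly p (y / x) = (\<Sum>k\<le>N. x ^ N * (coeff p k * (y / x) ^ k))"
    by (simp add: sum_distrib_left)
  also have "\<dots> = (\<Sum>k\<le>N. coeff p k * (x ^ (N - k) * y ^ k))"
    using assms(2) by (intro sum.cong refl) (auto simp: power_diff field_simps)
  finally show ?thesis by simp
qed

text \<open>Multiplying by (1 + y)^(2H) clears the denominators of the functional equation; in this
  form divisibility and the top coefficient can be read off.\<close>

lemma tau_inv_poly_eq:
  assumes "tau_inv \<epsilon> H p"
  shows "(\<Sum>k\<le>2*H. smult (coeff p k) ([:1,1:] ^ (2*H-k) * [:1,-1:] ^ k)) = smult (\<epsilon> * 2 ^ H) p"
proof (rule poly_eqI_cofinite[of "{0,1,-1}"])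
  fix y :: complex assume y: "y \<notin> {0,1,-1}"
  then have "1 + y \<noteq> 0" by (auto simp: add_eq_0_iff)
  have "poly (\<Sum>k\<le>2*H. smult (coeff p k) ([:1,1:] ^ (2*H-k) * [:1,-1:] ^ k)) y
      = (\<Sum>k\<le>2*H. coeff p k * ((1+y) ^ (2*H-k) * (1-y) ^ k))"
    by (simp add: poly_sum)
  also have "\<dots> = (1 + y) ^ (2 * H) * poly p ((1 - y) / (1 + y))"
    using assms \<open>1 + y \<noteq> 0\<close> by (intro homogenize_poly) (auto simp: tau_inv_def)
  also have "\<dots> = poly (smult (\<epsilon> * 2 ^ H) p) y"
    using assms y by (simp add: tau_inv_def)
  finally show "poly (\<Sum>k\<le>2*H. smult (coeff p k) ([:1,1:] ^ (2*H-k) * [:1,-1:] ^ k)) y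
     = poly (smult (\<epsilon> * 2 ^ H) p) y" .
qed simp

lemma coeff_pcompose_uminus: "coeff (pcompose p [:0, -1:]) n = (-1) ^ n * coeff (p :: complex poly) n"
proof (induction p arbitrary: n)
  case (pCons a p)
  show ?case by (cases n) (auto simp: pcompose_pCons pCons.IH)
qed simp

text \<open>The invariant \<open>x\<^sup>2 y\<^sup>2 (x\<^sup>2 - y\<^sup>2)\<^sup>2\<close> of degree 8, at \<open>x = 1\<close>.\<close>

definition octic :: "complex poly" where "octic = [:0,0,1:] * [:1,-1:]^2 * [:1,1:]^2"

lemma poly_octic: "poly octic y = y^2 * (1 - y^2)^2"
  by (simp add: octic_def power2_eq_square algebra_simps)

lemma degree_octic: "degree octic = 6" "octic \<noteq> 0"
  by (simp_all add: octic_def power2_eq_square)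

text \<open>A factor that does not vanish at \<open>a\<close> contributes nothing to the order
  there. This lets double roots at distinct points be split off one after another.\<close>

lemma linear_power_dvd_cancel:
  fixes u q :: "'a::field poly"
  assumes "poly u a \<noteq> 0" "[:-a,1:]^n dvd u * q"
  shows "[:-a,1:]^n dvd q"
proof (cases "q = 0")
  case False
  have "u \<noteq> 0" using assms(1) by auto
  then have "n \<le> order a (u * q)" using assms(2) False by (metis mult_eq_0_iff order_divides)
  also have "\<dots> = order a q" using \<open>u \<noteq> 0\<close> False assms(1) by (simp add: order_mult order_0I)
  finally show ?thesis using order_divides by blast
qed simp

text \<open>Evenness turns the zero at 0 into a double zero. In the transformed sum only terms with
  k >= 2 then survive, giving a double zero at 1, and evenness carries it to -1. The top coefficient
  of the transformed sum is p(-1), hence 0 as well.\<close>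

lemma tau_inv_dvd:
  assumes inv: "tau_inv \<epsilon> H p" and "\<epsilon> \<noteq> 0" and p0: "coeff p 0 = 0"
  shows "octic dvd p" and "coeff p (2*H) = 0"
proof -
  have ev: "coeff p n = (-1)^n * coeff p n" for n
    using inv coeff_pcompose_uminus[of p n] by (simp add: tau_inv_def)
  have p1: "coeff p 1 = 0" using ev[of 1] by (simp add: complex_eq_iff)
  have X: "[:0,0,1:] dvd p"
  proof -
    have "monom 1 2 dvd p" unfolding monom_1_dvd_iff'
      using p0 p1 by (auto simp: less_Suc_eq numeral_2_eq_2)
    then show ?thesis by (simp add: monom_altdef power2_eq_square)
  qed
  have "[:1,-1:]^2 dvd smult (\<epsilon> * 2 ^ H) p"
    unfolding tau_inv_poly_eq[OF inv, symmetric]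
  proof (intro dvd_sum)
    fix k
    show "[:1,-1:]^2 dvd smult (coeff p k) ([:1,1:] ^ (2*H-k) * [:1,-1:] ^ k)"
    proof (cases "k < 2")
      case True
      then have "coeff p k = 0" using p0 p1 by (auto simp: less_Suc_eq numeral_2_eq_2)
      then show ?thesis by simp
    next
      case False
      then show ?thesis by (intro dvd_smult dvd_mult le_imp_power_dvd) simp
    qed
  qed
  then have Y: "[:1,-1:]^2 dvd p" using assms(2) by (simp add: dvd_smult_iff)
  have "pcompose ([:1,-1:]^2) [:0,-1:] dvd pcompose p [:0,-1:]"
    using Y by (metis dvd_def pcompose_mult)
  then have Z: "[:1,1:]^2 dvd p"
    using inv by (simp add: tau_inv_def pcompose_mult power2_eq_square pcompose_pCons)
  have sq: "[:1,-1::complex:]^2 = [:-1,1:]^2" "[:1,1::complex:]^2 = [:-(-1),1:]^2"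
    by (simp_all add: power2_eq_square)
  obtain q where q: "p = [:0,0,1:] * q" using X by blast
  have "[:1,-1:]^2 dvd q" using Y unfolding q sq by (rule linear_power_dvd_cancel[rotated]) simp
  then obtain s where s: "q = [:1,-1:]^2 * s" by blast
  have "[:1,1:]^2 dvd s" using Z unfolding q s sq(2) mult.assoc[symmetric]
    by (rule linear_power_dvd_cancel[rotated]) simp
  then show "octic dvd p" unfolding q s octic_def mult.assoc[symmetric] by (intro mult_dvd_mono dvd_refl)
  have "poly p (-1) = 0" using Z by (metis dvd_power dvd_trans pos2 poly_eq_0_iff_dvd minus_minus)
  have "\<epsilon> * 2 ^ H * coeff p (2*H) = coeff (smult (\<epsilon> * 2 ^ H) p) (2*H)" by simp
  also have "\<dots> = (\<Sum>k\<le>2*H. coeff p k * coeff ([:1,1:] ^ (2*H-k) * [:1,-1:] ^ k) (2*H))"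
    unfolding tau_inv_poly_eq[OF inv, symmetric] by (simp add: coeff_sum)
  also have "\<dots> = (\<Sum>k\<le>2*H. coeff p k * (-1)^k)"
  proof (intro sum.cong refl)
    fix k assume k: "k \<in> {..2*H}"
    have "coeff ([:1,1::complex:] ^ (2*H-k) * [:1,-1:] ^ k) (degree ([:1,1::complex:] ^ (2*H-k)) + degree ([:1,-1::complex:] ^ k))
       = lead_coeff ([:1,1::complex:] ^ (2*H-k)) * lead_coeff ([:1,-1::complex:] ^ k)"
      by (rule coeff_mult_degree_sum)
    moreover have "degree ([:1,1::complex:] ^ (2*H-k)) + degree ([:1,-1::complex:] ^ k) = 2*H"
      using k by (simp add: degree_power_eq)
    moreover have "lead_coeff ([:1,1::complex:] ^ (2*H-k)) = 1" 
       unfolding lead_coeff_power by simp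
    moreover have "lead_coeff ([:1,-1::complex:] ^ k) = (-1)^k" 
       unfolding lead_coeff_power by simp
    ultimately show "coeff p k * coeff ([:1,1:] ^ (2*H-k) * [:1,-1:] ^ k) (2*H) = coeff p k * (-1)^k" by simp
  qed
  also have "\<dots> = poly p (-1)"
    using inv by (intro poly_altdef_le[symmetric]) (simp add: tau_inv_def)
  finally show "coeff p (2*H) = 0" using \<open>poly p (-1) = 0\<close> assms(2) by simp
qed


text \<open>The polynomial \<open>g\<close> in \<open>z = y\<^sup>2\<close> of degree \<open>d\<close> is the generator of the semi-invariants of sign \<open>\<epsilon>\<close> as a
  module over the invariants.\<close>

definition sign_factor :: "complex \<Rightarrow> complex poly \<Rightarrow> nat \<Rightarrow> bool" where
  "sign_factor \<epsilon> g d \<longleftrightarrow> \<epsilon> = 1 \<and> g = 1 \<and> d = 0 \<or> \<epsilon> = -1 \<and> g = [:1,-6,1:] \<and> d = 2"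

text \<open>For sign -1, \<open>poly g (y^2)\<close> is half the sum of (1 + iy)^4 and (1 - iy)^4.
  Up to division by 1 + y, the transform exchanges 1 + iy and 1 - iy with multipliers 1 + i and 1 -
  i, and (1 + i)^4 = (1 - i)^4 = -4.\<close>

lemma sign_factor_tau:
  assumes "sign_factor \<epsilon> g d" "(y::complex) \<noteq> -1"
  shows "(1 + y) ^ (2 * d) * poly g (((1 - y) / (1 + y))^2) = \<epsilon> * 2 ^ d * poly g (y^2)"
proof -
  have "1 + y \<noteq> 0" using assms(2) by (metis add.inverse_inverse add_eq_0_iff2)
  then have "(1 + y) ^ 4 * (1 - 6 * ((1 - y) / (1 + y))^2 + (((1 - y) / (1 + y))^2)^2) = - 4 * (1 - 6 * y^2 + (y^2)^2)"
    by (simp add: divide_simps) algebra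
  then show ?thesis using assms(1) unfolding sign_factor_def
    by (auto simp: algebra_simps power2_eq_square)
qed

lemma square_sum_tau:
  assumes "(y::complex) \<noteq> -1"
  shows "(1 + y) ^ (2 * h) * (1 + ((1 - y) / (1 + y))^2)^h = 2 ^ h * (1 + y^2)^h"
proof -
  have "1 + y \<noteq> 0" using assms by (metis add.inverse_inverse add_eq_0_iff2)
  then have "(1 + y) ^ 2 * (1 + ((1 - y) / (1 + y))^2) = 2 * (1 + y^2)"
    by (simp add: divide_simps) algebra
  then show ?thesis by (metis power_mult power_mult_distrib)
qed

lemma octic_tau:
  assumes "(y::complex) \<noteq> -1"
  shows "(1 + y) ^ 8 * poly octic ((1 - y) / (1 + y)) = 16 * poly octic y"
proof -
  have "1 + y \<noteq> 0" using assms by (metis add.inverse_inverse add_eq_0_iff2)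
  then show ?thesis unfolding poly_octic
    by (simp add: divide_simps) algebra
qed

text \<open>Induction on \<open>H\<close>: subtracting the multiple of g(y^2) (1 + y^2)^(H - d) with
  the same constant term leaves a semi-invariant vanishing at 0, hence \<open>octic\<close> times a
  semi-invariant for \<open>H - 4\<close>.\<close>

lemma gleason_expansion:
  assumes "sign_factor \<epsilon> g d" "even H" "tau_inv \<epsilon> H p"
  shows "\<exists>b. \<forall>y. poly p y = (\<Sum>j | d + 4 * j \<le> H.
           b j * (poly g (y^2) * (1 + y^2) ^ (H - d - 4 * j) * (y^2 * (1 - y^2)^2) ^ j))"
  using assms(2,3)
proof (induction H arbitrary: p rule: less_induct)
  case (less H)
  note inv = less.prems(2)
  have eps: "\<epsilon> \<noteq> 0" using assms(1) by (auto simp: sign_factor_def)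
  show ?case
  proof (cases "H < d")
    case True
    then have "\<epsilon> = -1" "d = 2" using assms(1) by (auto simp: sign_factor_def)
    \<comment> \<open>Evenness of \<open>H\<close> excludes \<open>H = 1\<close>; the constant that
      remains equals its own negative.\<close>
    then have "H = 0" using True less.prems(1) by (auto simp: less_2_cases_iff)
    then obtain c where c: "p = [:c:]" using inv degree_0_id[of p] 
      by (auto simp: tau_inv_def) (metis degree_0_id)
    have "(2::complex) \<notin> {0,1,-1}" by auto
    then have "(1 + 2) ^ (2 * H) * poly p ((1 - 2) / (1 + 2)) = \<epsilon> * 2 ^ H * poly p 2"
      using inv unfolding tau_inv_def by blast
    then have "c = - c" using c \<open>H = 0\<close> \<open>\<epsilon> = -1\<close> by simp
    then have "p = 0" using c by simp
    then show ?thesis using True by (intro exI[of _ "\<lambda>_. 0"]) auto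
  next
    case False
    define P where "P = smult (coeff p 0) (pcompose (g * [:1,1:]^(H-d)) [:0,0,1:])"
    have P: "poly P y = coeff p 0 * (poly g (y^2) * (1 + y^2) ^ (H - d))" for y
      by (simp add: P_def poly_pcompose power2_eq_square algebra_simps)
    define p1 where "p1 = p - P"
    have degP: "degree P \<le> 2 * H"
    proof -
      have "degree g \<le> d" using assms(1) by (auto simp: sign_factor_def)
      moreover have "degree ([:1,1::complex:]^(H-d)) = H - d" by (simp add: degree_power_eq)
      ultimately have "degree (g * [:1,1:]^(H-d)) \<le> H"
        using degree_mult_le[of g "[:1,1:]^(H-d)"] False by linarith
      then show ?thesis unfolding P_def
        by (intro order.trans[OF degree_smult_le]) (simp add: degree_pcompose)
    qed
    have inv1: "tau_inv \<epsilon> H p1" unfolding tau_inv_def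
    proof (intro conjI allI impI)
      show "degree p1 \<le> 2 * H" unfolding p1_def
        using degP inv by (intro degree_diff_le) (auto simp: tau_inv_def)
      have "pcompose P [:0,-1:] = P"
        by (rule poly_eqI_cofinite[of "{}"]) (auto simp: poly_pcompose P)
      then show "pcompose p1 [:0,-1:] = p1"
        using inv by (simp add: p1_def pcompose_diff tau_inv_def)
      fix y :: complex assume y: "y \<notin> {0,1,-1}"
      have "(1 + y) ^ (2 * H) = (1 + y) ^ (2 * d) * (1 + y) ^ (2 * (H - d))"
        using False power_add[of "1 + y" "2 * d" "2 * (H - d)"] by (simp add: right_diff_distrib')
      then have "(1 + y) ^ (2 * H) * poly P ((1 - y) / (1 + y))
        = coeff p 0 * (((1 + y) ^ (2 * d) * poly g (((1 - y) / (1 + y))^2))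
            * ((1 + y) ^ (2 * (H-d)) * (1 + ((1 - y) / (1 + y))^2)^(H-d)))"
        unfolding P by (simp only: mult_ac)
      also have "\<dots> = coeff p 0 * ((\<epsilon> * 2 ^ d * poly g (y^2)) * (2 ^ (H-d) * (1 + y^2)^(H-d)))"
        using y by (subst sign_factor_tau[OF assms(1)], simp, subst square_sum_tau) auto
      also have "\<dots> = \<epsilon> * (2 ^ d * 2 ^ (H-d)) * poly P y"
        unfolding P by (simp only: mult_ac)
      also have "(2::complex) ^ d * 2 ^ (H-d) = 2 ^ H"
        using False by (simp flip: power_add)
      finally show "(1 + y) ^ (2 * H) * poly p1 ((1 - y) / (1 + y)) = \<epsilon> * 2 ^ H * poly p1 y"
        using inv y by (simp add: p1_def tau_inv_def right_diff_distrib)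
    qed
    have "poly P 0 = coeff p 0" unfolding P using assms(1) by (auto simp: sign_factor_def)
    then have c0: "coeff p1 0 = 0" by (simp add: p1_def poly_0_coeff_0)
    note dv = tau_inv_dvd[OF inv1 eps c0]
    from dv(1) obtain q where q: "p1 = octic * q" by blast
    have pq: "poly p y = coeff p 0 * (poly g (y^2) * (1 + y^2) ^ (H - d)) 
         + (y^2 * (1 - y^2)^2) * poly q y" for y
      using arg_cong[OF q, of "\<lambda>p. poly p y"] by (simp add: p1_def P poly_octic algebra_simps)
    \<comment> \<open>As a form \<open>octic\<close> has degree 8, but its degree in y is 6: the
      vanishing top coefficient and evenness account for the other two.\<close>
    have deg: "degree q + 8 \<le> 2 * H" if "p1 \<noteq> 0"
    proof -
      have "degree p1 \<le> 2 * H" using inv1 by (simp add: tau_inv_def)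
      moreover have "degree p1 \<noteq> 2 * H" using dv(2) that by (metis leading_coeff_0_iff)
      moreover have "even (degree p1)"
      proof (rule ccontr)
        assume "odd (degree p1)"
        then have "lead_coeff p1 = - lead_coeff p1"
          using coeff_pcompose_uminus[of p1 "degree p1"] inv1 by (simp add: tau_inv_def)
        then show False using that by simp
      qed
      moreover have "degree p1 = 6 + degree q"
        using that q degree_octic by (metis degree_mult_eq mult_eq_0_iff)
      ultimately show ?thesis by presburger
    qed
    show ?thesis
    proof (cases "H < 4")
      case True
      then have "p1 = 0" using deg by auto
      then have "q = 0" using q degree_octic by auto
      moreover have "{j. d + 4 * j \<le> H} = {0}" using True False by auto
      ultimately show ?thesis using pq by (intro exI[of _ "\<lambda>_. coeff p 0"]) simp
    next
      case H4: False
      have "tau_inv \<epsilon> (H - 4) q" unfolding tau_inv_def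
      proof (intro conjI allI impI)
        show "degree q \<le> 2 * (H - 4)"
        proof (cases "p1 = 0")
          case True
          then show ?thesis using q degree_octic by auto
        next
          case False
          then show ?thesis using deg by linarith
        qed
        have "pcompose octic [:0,-1:] = octic"
          by (rule poly_eqI_cofinite[of "{}"]) (auto simp: poly_pcompose poly_octic)
        then have "octic * pcompose q [:0,-1:] = octic * q"
          using inv1 unfolding tau_inv_def q pcompose_mult by simp
        then show "pcompose q [:0,-1:] = q" using degree_octic by simp
        fix y :: complex assume y: "y \<notin> {0,1,-1}"
        then have y1: "y \<noteq> -1" by auto
        have pw: "(1 + y) ^ (2 * H) = (1 + y) ^ 8 * (1 + y) ^ (2 * (H - 4))"
          using H4 power_add[of "1 + y" 8 "2 * (H - 4)"] by (simp add: right_diff_distrib')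
        have nz: "poly octic y \<noteq> 0" using y unfolding poly_octic
          by (auto simp: power2_eq_1_iff)
        have "16 * poly octic y * ((1 + y) ^ (2 * (H - 4)) * poly q ((1 - y) / (1 + y)))
          = (1 + y) ^ (2 * H) * poly p1 ((1 - y) / (1 + y))"
          unfolding q poly_mult pw octic_tau[OF y1, symmetric] by (simp only: mult_ac)
        also have "\<dots> = \<epsilon> * 2 ^ H * (poly octic y * poly q y)"
          using inv1 y unfolding tau_inv_def q by simp
        also have "(2::complex) ^ H = 16 * 2 ^ (H - 4)"
          using H4 power_add[of "2::complex" 4 "H - 4"] by simp
        finally show "(1 + y) ^ (2 * (H - 4)) * poly q ((1 - y) / (1 + y)) = \<epsilon> * 2 ^ (H - 4) * poly q y"
          using nz by simp
      qed
      then obtain b where b: "\<And>y. poly q y = (\<Sum>j | d + 4 * j \<le> H - 4.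
           b j * (poly g (y^2) * (1 + y^2) ^ (H - 4 - d - 4 * j) * (y^2 * (1 - y^2)^2) ^ j))"
        using less.IH[of "H - 4" q] less.prems(1) H4 by auto
      have S: "{j. d + 4 * j \<le> H} = insert 0 (Suc ` {j. d + 4 * j \<le> H - 4})"
      proof -
        have "j \<in> insert 0 (Suc ` {j. d + 4 * j \<le> H - 4})" if "d + 4 * j \<le> H" for j
          using that H4 by (cases j) auto
        then show ?thesis using False H4 by auto
      qed
      have fin: "finite {j. d + 4 * j \<le> H - 4}" by (rule finite_subset[of _ "{..H}"]) auto
      have "poly p y = (\<Sum>j | d + 4 * j \<le> H. case_nat (coeff p 0) b j *
          (poly g (y^2) * (1 + y^2) ^ (H - d - 4 * j) * (y^2 * (1 - y^2)^2) ^ j))" (is "_ = sum ?F _") for y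
      proof -
        have "sum ?F {j. d + 4 * j \<le> H} = ?F 0 + (\<Sum>j | d + 4 * j \<le> H - 4. ?F (Suc j))"
          unfolding S by (subst sum.insert) (auto simp: fin sum.reindex simp del: power_Suc)
        also have "(\<Sum>j | d + 4 * j \<le> H - 4. ?F (Suc j)) = (y^2 * (1 - y^2)^2) * poly q y"
          unfolding b sum_distrib_left
        proof (intro sum.cong refl)
          fix j
          have "H - d - 4 * Suc j = H - 4 - d - 4 * j" by simp
          then show "?F (Suc j) = (y^2 * (1 - y^2)^2) * (b j * (poly g (y^2) *
             (1 + y^2) ^ (H - 4 - d - 4 * j) * (y^2 * (1 - y^2)^2) ^ j))"
            by (simp only: nat.case power_Suc mult_ac)
        qed
        finally show ?thesis using pq[of y] by simp
      qed
      then show ?thesis by blast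
    qed
  qed
qed

subsection \<open>Lagrange inversion\<close>

abbreviation fX :: "complex fps" where "fX \<equiv> fps_X"

text \<open>The operator X d/dX multiplies the coefficient of X^k by k. In terms of residues, an
  exact differential has residue 0.\<close>

lemma fps_nth_homogeneous_derivation:
  "fps_nth (of_nat k * f - fps_X * fps_deriv f) k = (0::'a::comm_ring_1)"
proof (cases k)
  case (Suc n)
  have "fps_nth (fps_X * fps_deriv f) (Suc n) = of_nat (Suc n) * fps_nth f (Suc n)"
    by simp
  moreover have "fps_nth (of_nat k * f) k = of_nat k * fps_nth f k"
    using fps_mult_left_const_nth[of "of_nat k" f k] by (simp add: fps_of_nat)
  ultimately show ?thesis using Suc by simp
qed (simp add: fps_mult_nth)

lemma inverse_one_minus_X: "(1 - fX) * inverse (1 - fX) = 1" "inverse (1 - fX) * (1 - fX) = 1"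
  "(1 + fX) * inverse (1 + fX) = 1"
  by (simp_all add: inverse_mult_eq_1 inverse_mult_eq_1')

lemma deriv_inverse_one_minus_X: "fps_deriv (inverse (1 - fX)) = inverse (1 - fX) ^ 2"
  by (subst fps_inverse_deriv) (simp_all add: power2_eq_square)

text \<open>The series is \<open>f - X f' / k\<close> for \<open>f = (1 + X)\<^sup>4\<^sup>k / (1 - X)\<^sup>2\<^sup>k\<close>, which has no term of degree \<open>k\<close>.
  Equivalently, \<open>t\<^sup>-\<^sup>k dt/t\<close> has residue 0 for \<open>t = X (1 - X)\<^sup>2 / (1 + X)\<^sup>4\<close>.\<close>

lemma lagrange_coeff_zero:
  assumes "k > 0"
  shows "fps_nth ((1 - 6 * fX + fX^2) * (1 + fX) ^ (4*k-1) * inverse (1 - fX) ^ (2*k+1)) k = 0"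
proof -
  define u where "u = inverse (1 - fX)"
  define a where "a = (1 + fX) ^ (4*k-1)"
  define c where "c = u ^ (2*k-1)"
  have u: "(1 - fX) * u = 1" unfolding u_def by (rule inverse_one_minus_X)
  have a: "(1 + fX) ^ (4*k) = (1 + fX) * a" using assms 
    by (simp add: a_def flip: power_Suc)
  have c: "u ^ (2*k) = u * c" "u ^ (2*k+1) = u * u * c" using assms
    by (cases k; simp add: c_def)+
  define f where "f = (1 + fX) ^ (4*k) * u ^ (2*k)"
  have "fps_deriv f = of_nat (4*k) * a * u^(2*k) + (1 + fX) ^ (4*k) * (of_nat (2*k) * c * u^2)"
    by (simp add: f_def fps_deriv_power a_def c_def deriv_inverse_one_minus_X[folded u_def] 
       algebra_simps flip: fps_of_nat)
  then have "of_nat k * f - fX * fps_deriv f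
     = of_nat k * ((1 + fX) * a * u * c - 4 * fX * a * u * c - 2 * fX * (1 + fX) * a * u^2 * c)"
    unfolding f_def a c by (simp add: algebra_simps power2_eq_square)
  also have "(1 + fX) * a * u * c - 4 * fX * a * u * c - 2 * fX * (1 + fX) * a * u^2 * c
     = (1 - 6 * fX + fX^2) * a * (u * u * c)"
    using u by algebra
  finally have "of_nat k * ((1 - 6 * fX + fX^2) * a * (u * u * c)) = of_nat k * f - fX * fps_deriv f" ..
  then have "fps_nth (of_nat k * ((1 - 6 * fX + fX^2) * a * (u * u * c))) k = 0"
    by (simp only: fps_nth_homogeneous_derivation)
  then have "of_nat k * fps_nth ((1 - 6 * fX + fX^2) * a * (u * u * c)) k = 0"
    by (metis fps_mult_left_const_nth fps_of_nat)
  then show ?thesis using assms unfolding u_def[symmetric] c a_def[symmetric] by simp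
qed

text \<open>The series is f - X f'/k for f = (1 - X)^(2k). Equivalently, s^(-k) ds/s has residue 0
  for s = X / (1 - X)^2.\<close>

lemma lagrange_coeff_zero_shadow:
  assumes "k > 0"
  shows "fps_nth ((1 + fX) * (1 - fX) ^ (2*k-1)) k = 0"
proof -
  define a where "a = (1 - fX) ^ (2*k-1)"
  define f where "f = (1 - fX) ^ (2*k)"
  have f: "f = (1 - fX) * a" using assms by (simp add: f_def a_def flip: power_Suc)
  have df: "fps_deriv f = - (of_nat (2*k) * a)"
  proof -
    have "fps_deriv f = fps_const (of_nat (2*k)) * fps_deriv (1 - fX) * a"
      unfolding f_def a_def by (rule fps_deriv_power)
    then show ?thesis unfolding fps_of_nat by simp
  qed
  have "of_nat k * f - fX * fps_deriv f = of_nat k * ((1 + fX) * a)"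
    unfolding df unfolding f by (simp add: algebra_simps)
  then have "fps_nth (of_nat k * ((1 + fX) * a)) k = 0"
    by (metis fps_nth_homogeneous_derivation)
  then have "of_nat k * fps_nth ((1 + fX) * a) k = 0"
    by (metis fps_mult_left_const_nth fps_of_nat)
  then show ?thesis using assms by (simp add: a_def)
qed

lemma power_mult_inverse_power:
  fixes x u :: "'a::comm_ring_1"
  assumes "x * u = 1"
  shows "n \<le> m \<Longrightarrow> x ^ n * u ^ m = u ^ (m - n)" "m \<le> n \<Longrightarrow> x ^ n * u ^ m = x ^ (n - m)"
proof -
  assume "n \<le> m"
  then have "x ^ n * u ^ m = (x * u) ^ n * u ^ (m - n)"
    by (simp add: power_mult_distrib mult.assoc flip: power_add)
  then show "x ^ n * u ^ m = u ^ (m - n)" using assms by simp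
next
  assume "m \<le> n"
  then have "x ^ n * u ^ m = (x * u) ^ m * x ^ (n - m)"
    by (simp add: power_mult_distrib mult_ac flip: power_add)
  then show "x ^ n * u ^ m = x ^ (n - m)" using assms by simp
qed

text \<open>Terms with j > J start beyond degree J, the term j = J starts with coefficient 1 in
  degree J, and for j < J the factor X^j shifts the index to k = J - j, where
  \<open>lagrange_coeff_zero\<close> applies. The multiplier thus acts as a dual basis
  vector.\<close>

lemma lagrange_extract:
  assumes "4 * J \<le> h"
  shows "fps_nth ((\<Sum>j | 4 * j \<le> h. fps_const (b j) *
             ((1 - 6 * fX + fX^2) * (1 + fX) ^ (h - 4*j) * (fX * (1 - fX)^2) ^ j))
           * inverse (1 + fX) ^ (h + 1 - 4*J) * inverse (1 - fX) ^ (2*J+1)) J = b J"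
proof -
  define u v where "u = inverse (1 - fX)" and "v = inverse (1 + fX)"
  have u: "(1 - fX) * u = 1" and v: "(1 + fX) * v = 1"
    unfolding u_def v_def by (rule inverse_one_minus_X)+
  have fin: "finite {j. 4 * j \<le> h}" by (rule finite_subset[of _ "{..h}"]) auto
  define T where "T j = (1 - 6 * fX + fX^2) * (1 + fX) ^ (h - 4*j) * (fX * (1 - fX)^2) ^ j
        * v ^ (h + 1 - 4*J) * u ^ (2*J+1)" for j
  have T: "fps_nth (T j) J = (if j = J then 1 else 0)" if j: "4 * j \<le> h" for j
  proof -
    have T': "T j = fX ^ j * ((1 - 6 * fX + fX^2) * ((1 + fX) ^ (h - 4*j) * v ^ (h + 1 - 4*J))
        * ((1 - fX) ^ (2*j) * u ^ (2*J+1)))"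
      unfolding T_def power_mult_distrib power_mult by (simp only: mult_ac)
    consider "j > J" | "j = J" | "j < J" by linarith
    then show ?thesis
    proof cases
      case 1
      then show ?thesis unfolding T' by (simp add: fps_X_power_mult_nth)
    next
      case 2
      have "fps_nth v 0 = 1" "fps_nth u 0 = 1"
        by (simp_all add: u_def v_def)
      then show ?thesis unfolding T' using 2 by (simp add: fps_X_power_mult_nth fps_nth_power_0)
    next
      case 3
      have c1: "(1 + fX) ^ (h - 4*j) * v ^ (h + 1 - 4*J) = (1 + fX) ^ (4*(J-j)-1)"
        using 3 assms by (subst power_mult_inverse_power(2)[OF v]) (auto intro!: arg_cong[of _ _ "\<lambda>n. _ ^ n"])
      have c2: "(1 - fX) ^ (2*j) * u ^ (2*J+1) = u ^ (2*(J-j)+1)"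
      proof -
        have "2*J+1 - 2*j = 2*(J-j)+1" using 3 by simp
        then show ?thesis using power_mult_inverse_power(1)[OF u, of "2*j" "2*J+1"] 3 by simp
      qed
      have "fps_nth (T j) J = fps_nth ((1 - 6 * fX + fX^2) * (1 + fX) ^ (4*(J-j)-1) * u ^ (2*(J-j)+1)) (J - j)"
        unfolding T' c1 c2 using 3 by (subst fps_X_power_mult_nth) auto
      then show ?thesis using 3 lagrange_coeff_zero[of "J - j", folded u_def] by simp
    qed
  qed
  have "(\<Sum>j | 4 * j \<le> h. fps_const (b j) *
             ((1 - 6 * fX + fX^2) * (1 + fX) ^ (h - 4*j) * (fX * (1 - fX)^2) ^ j))
           * inverse (1 + fX) ^ (h + 1 - 4*J) * inverse (1 - fX) ^ (2*J+1)
      = (\<Sum>j | 4 * j \<le> h. fps_const (b j) * T j)"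
    unfolding sum_distrib_right T_def u_def v_def by (simp only: mult_ac)
  then have "fps_nth ((\<Sum>j | 4 * j \<le> h. fps_const (b j) *
             ((1 - 6 * fX + fX^2) * (1 + fX) ^ (h - 4*j) * (fX * (1 - fX)^2) ^ j))
           * inverse (1 + fX) ^ (h + 1 - 4*J) * inverse (1 - fX) ^ (2*J+1)) J
      = (\<Sum>j | 4 * j \<le> h. b j * fps_nth (T j) J)"
    by (simp add: fps_sum_nth)
  also have "\<dots> = (\<Sum>j | 4 * j \<le> h. if j = J then b j else 0)"
    by (intro sum.cong refl) (simp add: T)
  finally show ?thesis using fin assms by simp
qed

text \<open>In the shadow expansion the power of X decreases with j: terms with j < J start too
  late, and those with j > J vanish by \<open>lagrange_coeff_zero_shadow\<close>.\<close>

lemma lagrange_extract_shadow: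
  assumes "J \<le> M"
  shows "fps_nth ((\<Sum>j\<le>M. fps_const (e j) * ((1 + fX) * fX ^ (M - j) * (1 - fX) ^ (2*j)))
           * inverse (1 - fX) ^ (2*J+1)) (M - J) = e J"
proof -
  define u where "u = inverse (1 - fX)"
  have u: "(1 - fX) * u = 1" unfolding u_def by (rule inverse_one_minus_X)
  define T where "T j = (1 + fX) * fX ^ (M - j) * (1 - fX) ^ (2*j) * u ^ (2*J+1)" for j
  have T: "fps_nth (T j) (M - J) = (if j = J then 1 else 0)" if j: "j \<le> M" for j
  proof -
    have T': "T j = fX ^ (M - j) * ((1 + fX) * ((1 - fX) ^ (2*j) * u ^ (2*J+1)))"
      unfolding T_def by (simp only: mult_ac)
    consider "j < J" | "j = J" | "j > J" by linarith
    then show ?thesis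
    proof cases
      case 1
      then show ?thesis unfolding T' using assms by (simp add: fps_X_power_mult_nth)
    next
      case 2
      have "fps_nth u 0 = 1"
        by (simp add: u_def)
      then show ?thesis unfolding T' using 2 by (simp add: fps_X_power_mult_nth fps_nth_power_0)
    next
      case 3
      have c2: "(1 - fX) ^ (2*j) * u ^ (2*J+1) = (1 - fX) ^ (2*(j-J)-1)"
        using 3 by (subst power_mult_inverse_power(2)[OF u]) (auto intro!: arg_cong[of _ _ "\<lambda>n. _ ^ n"])
      have "M - J - (M - j) = j - J" using 3 j by auto
      then have "fps_nth (T j) (M - J) = fps_nth ((1 + fX) * (1 - fX) ^ (2*(j-J)-1)) (j - J)"
        unfolding T' c2 using 3 j by (subst fps_X_power_mult_nth) auto
      then show ?thesis using 3 lagrange_coeff_zero_shadow[of "j - J"] by simp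
    qed
  qed
  have "(\<Sum>j\<le>M. fps_const (e j) * ((1 + fX) * fX ^ (M - j) * (1 - fX) ^ (2*j)))
           * inverse (1 - fX) ^ (2*J+1)
      = (\<Sum>j\<le>M. fps_const (e j) * T j)"
    unfolding sum_distrib_right T_def u_def by (simp only: mult_ac)
  then have "fps_nth ((\<Sum>j\<le>M. fps_const (e j) * ((1 + fX) * fX ^ (M - j) * (1 - fX) ^ (2*j)))
           * inverse (1 - fX) ^ (2*J+1)) (M - J)
      = (\<Sum>j\<le>M. e j * fps_nth (T j) (M - J))"
    by (simp add: fps_sum_nth)
  also have "\<dots> = (\<Sum>j\<le>M. if j = J then e j else 0)"
    by (intro sum.cong refl) (simp add: T)
  finally show ?thesis using assms by simp
qed

section \<open>Comparing the coefficients of a polynomial with those of its shadow transform\<close>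

lemma coeff_pcompose_monom_one:
  assumes "n > 0"
  shows "coeff (pcompose f (monom (1::'a::comm_semiring_1) n)) (n * k) = coeff f k"
proof (induction f arbitrary: k)
  case (pCons a f)
  show ?case
  proof (cases k)
    case 0
    then show ?thesis using assms by (simp add: pcompose_pCons coeff_monom_mult)
  next
    case (Suc l)
    then have "n * k = n + n * l" by simp
    then show ?thesis using assms Suc pCons.IH[of l]
      by (simp add: pcompose_pCons coeff_monom_mult coeff_pCons split: nat.splits)
  qed
qed simp

text \<open>Up to degree \<open>J\<close> the series \<open>P\<close> is just its constant term.
  This is how a large minimum distance enters.\<close>

lemma fps_nth_low_mult:
  fixes P F :: "'a::semiring_0 fps"
  assumes "\<And>i. i \<in> {1..J} \<Longrightarrow> fps_nth P i = 0"
  shows "fps_nth (P * F) J = fps_nth P 0 * fps_nth F J"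
proof -
  have "fps_nth (P * F) J = (\<Sum>i=0..J. fps_nth P i * fps_nth F (J - i))" by (rule fps_mult_nth)
  also have "\<dots> = (\<Sum>i\<in>{0}. fps_nth P i * fps_nth F (J - i))"
    using assms by (intro sum.mono_neutral_right) (auto simp: Suc_le_eq)
  finally show ?thesis by simp
qed

text \<open>Here \<open>Q\<close> is the shadow transform of \<open>p\<close>. Both sides compute, up to a constant, the coefficient
  of index \<open>J\<close> in the Gleason expansion of \<open>p\<close>. The conditionals on \<open>d\<close> distinguish the two
  signs: \<open>d = 0\<close> for invariants, \<open>d = 2\<close> for sign \<open>-1\<close>.\<close>

lemma enumerator_identity:
  fixes p Q :: "complex poly"
  assumes sf: "sign_factor \<epsilon> g d" and H: "even H" "d \<le> H" and inv: "tau_inv \<epsilon> H p"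
    and Q: "\<And>y. y \<notin> {0,1,-1} \<Longrightarrow> K * poly Q y = (1 + y) ^ (2 * H) * poly p (\<i> * (1 - y) / (1 + y))"
    and low: "\<And>k. k \<in> {1..J} \<Longrightarrow> coeff p (2 * k) = 0"
    and h: "h = H - d" "4 * J \<le> h"
  shows "K * (\<Sum>l\<le>h div 4 - J. coeff Q (h mod 4 + 4 * l) *
             fps_nth ((if d = 0 then 1 + fX else 1) * inverse (1 - fX) ^ (2 * J + 1)) (h div 4 - J - l))
       = (if d = 0 then 1 else 8) * 4 ^ (h - 4 * J) * (-4) ^ J * coeff p 0 *
         fps_nth ((if d = 0 then 1 - 6 * fX + fX^2 else 1) * inverse (1 + fX) ^ (h + 1 - 4 * J)
            * inverse (1 - fX) ^ (2 * J + 1)) J"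
proof -
  define M where "M = h div 4"
  define r where "r = h mod 4"
  \<comment> \<open>The shadow substitution z = i(1 - y)/(1 + y) sends g(z^2) to
    \<open>c * poly gw (y^4)\<close> up to a power of 1 + y. The cofactors \<open>g'\<close> and
    \<open>gw'\<close> complete \<open>g\<close> and \<open>gw\<close> to the numerators 1 - 6X +
    X^2 and 1 + X of the two extraction lemmas, so both signs are treated alike.\<close>
  define c where "c = (if d = 0 then 1 else 8 :: complex)"
  define gw where "gw = (if d = 0 then 1 else [:1,1::complex:])"
  define gw' where "gw' = (if d = 0 then 1 + fX else 1)"
  define g' where "g' = (if d = 0 then 1 - 6 * fX + fX^2 else 1)"
  have gg': "fps_of_poly g * g' = 1 - 6 * fX + fX^2"
    using sf unfolding sign_factor_def
  proof
    assume "\<epsilon> = - 1 \<and> g = [:1,-6,1:] \<and> d = 2"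
    moreover have "fps_const (- 6) = - (6 :: complex fps)" by (simp add: numeral_fps_const)
    ultimately show ?thesis by (simp add: g'_def fps_of_poly_pCons algebra_simps power2_eq_square)
  qed (simp add: g'_def)
  have gwgw': "fps_of_poly gw * gw' = 1 + fX"
    by (auto simp: gw_def gw'_def fps_of_poly_pCons algebra_simps)
  have fin: "finite {j. 4 * j \<le> h}" by (rule finite_subset[of _ "{..h}"]) auto
  have S: "{j. d + 4 * j \<le> H} = {j. 4 * j \<le> h}" using h H by auto
  have SM: "{j. 4 * j \<le> h} = {..M}" by (auto simp: M_def)
  obtain b where b: "\<And>y. poly p y = (\<Sum>j | 4 * j \<le> h.
           b j * (poly g (y^2) * (1 + y^2) ^ (h - 4 * j) * (y^2 * (1 - y^2)^2) ^ j))"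
    using gleason_expansion[OF sf H(1) inv] unfolding S h(1)[symmetric] by blast

  \<comment> \<open>The expansion involves only y^2; \<open>P\<close> is \<open>p\<close> written in
    that variable.\<close>
  define P where "P = (\<Sum>j | 4 * j \<le> h. [:b j:] * (g * [:1,1:] ^ (h - 4 * j) * ([:0,1:] * [:1,-1:]^2) ^ j))"
  have "p = pcompose P (monom 1 2)"
    by (rule poly_eqI_cofinite[of "{}"])
       (auto simp: b P_def poly_pcompose poly_sum poly_monom algebra_simps intro!: sum.cong)
  then have cP: "coeff P k = coeff p (2 * k)" for k
    using coeff_pcompose_monom_one[of 2 P k] by simp
  define F where "F = g' * inverse (1 + fX) ^ (h + 1 - 4 * J) * inverse (1 - fX) ^ (2 * J + 1)"
  have e0: "fps_of_poly P * g' = (\<Sum>j | 4 * j \<le> h. fps_const (b j) *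
             ((1 - 6 * fX + fX^2) * (1 + fX) ^ (h - 4*j) * (fX * (1 - fX)^2) ^ j))"
    unfolding P_def fps_of_poly_sum sum_distrib_right
  proof (intro sum.cong refl)
    fix j
    have "fps_of_poly [:1,1:] = 1 + fX" "fps_of_poly [:1,-1:] = 1 - fX" "fps_of_poly [:0,1:] = fX"
      by (simp_all add: fps_of_poly_pCons)
    then have "fps_of_poly ([:b j:] * (g * [:1,1:] ^ (h - 4 * j) * ([:0,1:] * [:1,-1:]^2) ^ j)) * g'
      = fps_const (b j) * ((fps_of_poly g * g') * (1 + fX) ^ (h - 4*j) * (fX * (1 - fX)^2) ^ j)"
      unfolding fps_of_poly_mult fps_of_poly_power fps_of_poly_const by (simp only: mult_ac)
    then show "fps_of_poly ([:b j:] * (g * [:1,1:] ^ (h - 4 * j) * ([:0,1:] * [:1,-1:]^2) ^ j)) * g'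
      = fps_const (b j) * ((1 - 6 * fX + fX^2) * (1 + fX) ^ (h - 4*j) * (fX * (1 - fX)^2) ^ j)"
      unfolding gg' .
  qed
  have "fps_nth (fps_of_poly P * F) J = b J"
    unfolding F_def mult.assoc[symmetric] unfolding e0 by (rule lagrange_extract[OF h(2)])
  moreover have "fps_nth (fps_of_poly P * F) J = fps_nth (fps_of_poly P) 0 * fps_nth F J"
    by (rule fps_nth_low_mult) (use low cP in auto)
  ultimately have bJ: "b J = coeff p 0 * fps_nth F J" by (simp add: cP)

  \<comment> \<open>After clearing denominators, 1 + z^2 becomes 4y and z^2 (1 - z^2)^2 becomes -4
    (1 - y^4)^2; hence the powers of 4 and -4. Writing h = 4M + r makes \<open>smult K Q\<close>
    equal to y^r R(y^4).\<close>
  define e where "e j = b j * c * 4 ^ (h - 4 * j) * (-4) ^ j" for j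
  define R where "R = (\<Sum>j\<le>M. [:e j:] * (gw * [:0,1:] ^ (M - j) * [:1,-1:] ^ (2*j)))"
  have "smult K Q = monom 1 r * pcompose R (monom 1 4)"
  proof (rule poly_eqI_cofinite[of "{0,1,-1}"])
    fix y :: complex assume y: "y \<notin> {0,1,-1}"
    then have y1: "1 + y \<noteq> 0" by (auto simp: add_eq_0_iff)
    define z where "z = \<i> * (1 - y) / (1 + y)"
    have z2: "z^2 = - ((1 - y)^2 / (1 + y)^2)" by (simp add: z_def power_divide power_mult_distrib)
    have e1: "(1 + y)^2 * (1 + z^2) = 4 * y"
      unfolding z2 using y1 by (simp add: divide_simps) algebra
    have e2: "(1 + y)^8 * (z^2 * (1 - z^2)^2) = -4 * (1 - y^4)^2"
      unfolding z2 using y1 by (simp add: divide_simps) algebra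
    have e3: "(1 + y)^(2*d) * poly g (z^2) = c * poly gw (y^4)"
    proof -
      have "(1 + y)^4 * (1 - 6 * z^2 + (z^2)^2) = 8 * (1 + y^4)"
        unfolding z2 using y1 by (simp add: divide_simps) algebra
      then show ?thesis using sf
        by (auto simp: sign_factor_def c_def gw_def algebra_simps power2_eq_square)
    qed
    have "poly (smult K Q) y = (1 + y) ^ (2 * H) * poly p z"
      using Q[OF y] by (simp add: z_def)
    also have "\<dots> = (\<Sum>j | 4 * j \<le> h. e j * (poly gw (y^4) * y ^ (h - 4 * j) * (1 - y^4) ^ (2 * j)))"
      unfolding b sum_distrib_left
    proof (intro sum.cong refl)
      fix j assume "j \<in> {j. 4 * j \<le> h}"
      then have "2 * H = 2 * d + 2 * (h - 4 * j) + 8 * j" using h H by auto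
      then have pw: "(1 + y) ^ (2 * H) = (1 + y) ^ (2 * d) * ((1 + y)^2) ^ (h - 4 * j) * ((1 + y) ^ 8) ^ j"
        by (simp only: power_add power_mult)
      have "(1 + y) ^ (2 * H) * (b j * (poly g (z^2) * (1 + z^2) ^ (h - 4 * j) * (z^2 * (1 - z^2)^2) ^ j))
        = b j * (((1 + y)^(2*d) * poly g (z^2)) * ((1 + y)^2 * (1 + z^2)) ^ (h - 4 * j) *
            ((1 + y)^8 * (z^2 * (1 - z^2)^2)) ^ j)"
        unfolding pw power_mult_distrib by (simp only: mult_ac)
      also have "\<dots> = e j * (poly gw (y^4) * y ^ (h - 4 * j) * (1 - y^4) ^ (2 * j))"
        unfolding e1 e2 e3 unfolding e_def power_mult_distrib power_mult by (simp only: mult_ac)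
      finally show "(1 + y) ^ (2 * H) * (b j * (poly g (z^2) * (1 + z^2) ^ (h - 4 * j) * (z^2 * (1 - z^2)^2) ^ j))
        = e j * (poly gw (y^4) * y ^ (h - 4 * j) * (1 - y^4) ^ (2 * j))" .
    qed
    also have "\<dots> = (\<Sum>j\<le>M. y ^ r * (e j * (poly gw (y^4) * (y^4) ^ (M - j) * (1 - y^4) ^ (2 * j))))"
      unfolding SM
    proof (intro sum.cong refl)
      fix j assume "j \<in> {..M}"
      moreover have hM: "h = r + 4 * M" by (simp add: M_def r_def)
      ultimately have "h - 4 * j = r + 4 * (M - j)"
        using hM by (simp add: right_diff_distrib')
      then have "y ^ (h - 4 * j) = y ^ r * (y^4) ^ (M - j)"
        by (simp add: power_add power_mult)
      then show "e j * (poly gw (y^4) * y ^ (h - 4 * j) * (1 - y^4) ^ (2 * j))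
        = y ^ r * (e j * (poly gw (y^4) * (y^4) ^ (M - j) * (1 - y^4) ^ (2 * j)))"
        by (simp only: mult_ac)
    qed
    also have "\<dots> = poly (monom 1 r * pcompose R (monom 1 4)) y"
      by (simp add: R_def poly_monom poly_pcompose poly_sum sum_distrib_left)
    finally show "poly (smult K Q) y = poly (monom 1 r * pcompose R (monom 1 4)) y" .
  qed simp
  then have "coeff (smult K Q) (r + 4 * l) = coeff (monom 1 r * pcompose R (monom 1 4)) (r + 4 * l)" for l
    by simp
  then have cR: "K * coeff Q (r + 4 * l) = coeff R l" for l
    using coeff_pcompose_monom_one[of 4 R l] by (simp add: coeff_monom_mult)
  define G where "G = gw' * inverse (1 - fX) ^ (2 * J + 1)"
  have "fps_of_poly R * gw' = (\<Sum>j\<le>M. fps_const (e j) * ((1 + fX) * fX ^ (M - j) * (1 - fX) ^ (2*j)))"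
    unfolding R_def fps_of_poly_sum sum_distrib_right
  proof (intro sum.cong refl)
    fix j
    have "fps_of_poly [:1,-1:] = 1 - fX" "fps_of_poly [:0,1:] = fX"
      by (simp_all add: fps_of_poly_pCons)
    then have "fps_of_poly ([:e j:] * (gw * [:0,1:] ^ (M - j) * [:1,-1:] ^ (2*j))) * gw'
      = fps_const (e j) * ((fps_of_poly gw * gw') * fX ^ (M - j) * (1 - fX) ^ (2*j))"
      unfolding fps_of_poly_mult fps_of_poly_power fps_of_poly_const by (simp only: mult_ac)
    then show "fps_of_poly ([:e j:] * (gw * [:0,1:] ^ (M - j) * [:1,-1:] ^ (2*j))) * gw'
      = fps_const (e j) * ((1 + fX) * fX ^ (M - j) * (1 - fX) ^ (2*j))"
      unfolding gwgw' .
  qed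
  then have e1: "fps_of_poly R * G = (\<Sum>j\<le>M. fps_const (e j) * ((1 + fX) * fX ^ (M - j) * (1 - fX) ^ (2*j)))
       * inverse (1 - fX) ^ (2 * J + 1)"
    unfolding G_def mult.assoc[of "fps_of_poly R", symmetric] by (rule arg_cong)
  have "J \<le> M" using h(2) by (simp add: M_def)
  then have "fps_nth (fps_of_poly R * G) (M - J) = e J"
    unfolding e1 by (rule lagrange_extract_shadow)
  then have "e J = fps_nth (fps_of_poly R * G) (M - J)" ..
  also have "\<dots> = K * (\<Sum>l\<le>M - J. coeff Q (r + 4 * l) * fps_nth G (M - J - l))"
    by (simp add: fps_mult_nth cR[symmetric] sum_distrib_left mult.assoc atMost_atLeast0)
  finally have "K * (\<Sum>l\<le>M - J. coeff Q (r + 4 * l) * fps_nth G (M - J - l)) = e J" ..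
  also have "\<dots> = c * 4 ^ (h - 4 * J) * (-4) ^ J * coeff p 0 * fps_nth F J"
    unfolding e_def bJ by (simp only: mult_ac)
  finally show ?thesis unfolding M_def r_def G_def F_def gw'_def g'_def c_def .
qed

subsection \<open>Weight enumerators and shadows\<close>

text \<open>A binary linear code with each word replaced by its support: addition becomes symmetric
  difference, and the inner product becomes the parity of an intersection.\<close>

definition binary_code :: "'a set \<Rightarrow> 'a set set \<Rightarrow> bool" where
  "binary_code T E \<longleftrightarrow> E \<subseteq> Pow T \<and> {} \<in> E \<and> (\<forall>a\<in>E. \<forall>b\<in>E. sym_diff a b \<in> E)"

definition dual_sets :: "'a set \<Rightarrow> 'a set set \<Rightarrow> 'a set set" where
  "dual_sets T E = {v. v \<subseteq> T \<and> (\<forall>c\<in>E. even (card (v \<inter> c)))}"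

text \<open>On a self-orthogonal code, c -> (-1)^(|c|/2) is a character; the shadow collects the
  vectors representing it through the inner product. It is the dual code itself when all weights of
  \<open>E\<close> are divisible by 4.\<close>

definition shadow :: "'a set \<Rightarrow> 'a set set \<Rightarrow> 'a set set" where
  "shadow T E = {v. v \<subseteq> T \<and> (\<forall>c\<in>E. even (card (v \<inter> c)) \<longleftrightarrow> even (card c div 2))}"

definition enum_poly :: "'a set set \<Rightarrow> complex poly" where
  "enum_poly E = (\<Sum>c\<in>E. monom 1 (card c))"

definition hom_enum :: "nat \<Rightarrow> 'a set set \<Rightarrow> complex \<Rightarrow> complex \<Rightarrow> complex" where
  "hom_enum n E x y = (\<Sum>c\<in>E. x ^ (n - card c) * y ^ card c)"

lemma card_sym_diff:
  assumes "finite a" "finite b"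
  shows "card (sym_diff a b) + 2 * card (a \<inter> b) = card a + card b"
proof -
  have "card (sym_diff a b) = card (a - b) + card (b - a)"
    using assms by (intro card_Un_disjoint) auto
  moreover have "card a = card (a - b) + card (a \<inter> b)"
    using assms by (subst card_Un_disjoint[symmetric]) (auto intro!: arg_cong[of _ _ card])
  moreover have "card b = card (b - a) + card (a \<inter> b)"
    using assms by (subst card_Un_disjoint[symmetric]) (auto intro!: arg_cong[of _ _ card])
  ultimately show ?thesis by simp
qed

lemma even_card_Int_sym_diff:
  assumes "finite v"
  shows "even (card (v \<inter> sym_diff a b)) \<longleftrightarrow> (even (card (v \<inter> a)) \<longleftrightarrow> even (card (v \<inter> b)))"
proof -
  have "v \<inter> sym_diff a b = sym_diff (v \<inter> a) (v \<inter> b)" by auto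
  then have "card (v \<inter> sym_diff a b) + 2 * card ((v \<inter> a) \<inter> (v \<inter> b)) = card (v \<inter> a) + card (v \<inter> b)"
    using card_sym_diff[of "v \<inter> a" "v \<inter> b"] assms by simp
  then show ?thesis by presburger
qed

lemma sum_over_code_shift:
  assumes "binary_code T E" "c \<in> E"
  shows "(\<Sum>b\<in>E. f (sym_diff c b)) = (\<Sum>b\<in>E. f b)"
  by (rule sum.reindex_bij_witness[of _ "sym_diff c" "sym_diff c"])
     (use assms in \<open>auto simp: binary_code_def\<close>)

text \<open>Translation by a word on which \<psi> fails permutes the code and flips every sign, so
  the sum equals its own negative.\<close>

lemma character_sum:
  fixes \<psi> :: "'a set \<Rightarrow> bool"
  assumes E: "binary_code T E" and hom: "\<And>a b. a \<in> E \<Longrightarrow> b \<in> E \<Longrightarrow> \<psi> (sym_diff a b) \<longleftrightarrow> (\<psi> a \<longleftrightarrow> \<psi> b)"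
  shows "(\<Sum>c\<in>E. if \<psi> c then 1 else -1) = (if \<forall>c\<in>E. \<psi> c then of_nat (card E) else (0::complex))"
proof (cases "\<forall>c\<in>E. \<psi> c")
  case False
  then obtain c where c: "c \<in> E" "\<not> \<psi> c" by blast
  have "(\<Sum>b\<in>E. if \<psi> b then 1 else -1::complex) = (\<Sum>b\<in>E. if \<psi> (sym_diff c b) then 1 else -1)"
    by (rule sum_over_code_shift[OF E c(1), symmetric])
  also have "\<dots> = (\<Sum>b\<in>E. - (if \<psi> b then 1 else -1))"
    using c by (intro sum.cong refl) (subst hom, auto)
  finally have "(\<Sum>b\<in>E. if \<psi> b then 1 else -1::complex) = 0"
    by (simp add: sum_negf)
  then show ?thesis unfolding if_not_P[OF False] .
qed simp

text \<open>Poisson summation: (x + y)^(n - |c|) (x - y)^|c| is a product over \<open>T\<close>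
  whose expansion runs over all subsets v with sign (-1)^|v \<inter> c|. Summing over c first keeps
  exactly the v whose character agrees with \<chi>.\<close>

lemma hom_enum_character:
  fixes \<chi> :: "'a set \<Rightarrow> bool"
  assumes T: "finite T" "card T = n" and E: "binary_code T E"
    and hom: "\<And>a b. a \<in> E \<Longrightarrow> b \<in> E \<Longrightarrow> \<chi> (sym_diff a b) \<longleftrightarrow> (\<chi> a \<longleftrightarrow> \<chi> b)"
  shows "(\<Sum>c\<in>E. (if \<chi> c then 1 else -1) * ((x + y) ^ (n - card c) * (x - y) ^ card c))
     = of_nat (card E) * hom_enum n {v. v \<subseteq> T \<and> (\<forall>c\<in>E. even (card (v \<inter> c)) \<longleftrightarrow> \<chi> c)} x y"
proof -
  define s where "s v c = (if even (card (v \<inter> c)) then 1 else -1 :: complex)" for v c :: "'a set"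
  have fin: "finite E" using E T by (meson binary_code_def finite_Pow_iff finite_subset)
  have c: "(x + y) ^ (n - card c) * (x - y) ^ card c
      = (\<Sum>v\<in>Pow T. s v c * (x ^ (n - card v) * y ^ card v))" if "c \<in> E" for c
  proof -
    have cT: "c \<subseteq> T" "finite c" using that E T by (auto simp: binary_code_def intro: finite_subset)
    have "(\<Prod>i\<in>T. (if i \<in> c then -y else y) + x) = (\<Prod>i\<in>T. if i \<in> c then x - y else x + y)"
      by (intro prod.cong) auto
    also have "\<dots> = (x - y) ^ card (T \<inter> c) * (x + y) ^ card (T \<inter> - c)"
      using T by (simp add: prod.If_cases)
    also have "T \<inter> c = c" using cT by auto
    also have "card (T \<inter> - c) = n - card c" using cT T
      by (metis Diff_eq card_Diff_subset)
    finally have "(x + y) ^ (n - card c) * (x - y) ^ card c = (\<Prod>i\<in>T. (if i \<in> c then -y else y) + x)"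
      by (simp add: mult.commute)
    also have "\<dots> = (\<Sum>v\<in>Pow T. (\<Prod>i\<in>v. if i \<in> c then -y else y) * (\<Prod>i\<in>T - v. x))"
      by (rule prod_add[OF T(1)])
    also have "\<dots> = (\<Sum>v\<in>Pow T. s v c * (x ^ (n - card v) * y ^ card v))"
    proof (intro sum.cong refl)
      fix v assume "v \<in> Pow T"
      then have v: "v \<subseteq> T" "finite v" using T by (auto intro: finite_subset)
      have "(\<Prod>i\<in>v. if i \<in> c then -y else y) = (\<Prod>i\<in>v. (if i \<in> c then -1 else 1) * y)"
        by (intro prod.cong) auto
      also have "\<dots> = s v c * y ^ card v"
        using v by (simp add: prod.distrib prod.If_cases s_def uminus_power_if)
      finally show "(\<Prod>i\<in>v. if i \<in> c then -y else y) * (\<Prod>i\<in>T - v. x) = s v c * (x ^ (n - card v) * y ^ card v)"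
        using v T by (simp add: card_Diff_subset)
    qed
    finally show ?thesis .
  qed
  have "(\<Sum>c\<in>E. (if \<chi> c then 1 else -1) * ((x + y) ^ (n - card c) * (x - y) ^ card c))
      = (\<Sum>c\<in>E. \<Sum>v\<in>Pow T. (if even (card (v \<inter> c)) \<longleftrightarrow> \<chi> c then 1 else -1) * (x ^ (n - card v) * y ^ card v))"
    by (intro sum.cong refl) (auto simp: c s_def sum_distrib_left intro!: sum.cong)
  also have "\<dots> = (\<Sum>v\<in>Pow T. (\<Sum>c\<in>E. if even (card (v \<inter> c)) \<longleftrightarrow> \<chi> c then 1 else -1) * (x ^ (n - card v) * y ^ card v))"
    by (subst sum.swap) (simp add: sum_distrib_right)
  also have "\<dots> = (\<Sum>v\<in>Pow T. if \<forall>c\<in>E. even (card (v \<inter> c)) \<longleftrightarrow> \<chi> c 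
        then of_nat (card E) * (x ^ (n - card v) * y ^ card v) else 0)"
  proof (intro sum.cong refl)
    fix v assume "v \<in> Pow T"
    then have "finite v" using T by (auto intro: finite_subset)
    then have "(\<Sum>c\<in>E. if even (card (v \<inter> c)) \<longleftrightarrow> \<chi> c then 1 else -1) =
        (if \<forall>c\<in>E. even (card (v \<inter> c)) \<longleftrightarrow> \<chi> c then of_nat (card E) else (0::complex))"
      by (intro character_sum[OF E]) (auto simp: even_card_Int_sym_diff hom)
    then show "(\<Sum>c\<in>E. if even (card (v \<inter> c)) \<longleftrightarrow> \<chi> c then 1 else -1) * (x ^ (n - card v) * y ^ card v)
      = (if \<forall>c\<in>E. even (card (v \<inter> c)) \<longleftrightarrow> \<chi> c 
        then of_nat (card E) * (x ^ (n - card v) * y ^ card v) else 0)" by simp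
  qed
  also have "\<dots> = of_nat (card E) * hom_enum n {v. v \<subseteq> T \<and> (\<forall>c\<in>E. even (card (v \<inter> c)) \<longleftrightarrow> \<chi> c)} x y"
    using T by (simp add: hom_enum_def sum_distrib_left sum.If_cases Pow_def Collect_conj_eq)
  finally show ?thesis .
qed

lemma macwilliams:
  assumes "finite T" "card T = n" "binary_code T E"
  shows "hom_enum n E (x + y) (x - y) = of_nat (card E) * hom_enum n (dual_sets T E) x y"
  using hom_enum_character[OF assms, of "\<lambda>_. True" x y] by (simp add: hom_enum_def dual_sets_def)

text \<open>On words of even weight i^|c| is the sign (-1)^(|c|/2), which is multiplicative because
  two words of a self-orthogonal code meet evenly.\<close>

lemma hom_enum_shadow:
  assumes "finite T" "card T = n" and E: "binary_code T E" "E \<subseteq> dual_sets T E"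
  shows "hom_enum n E (x + y) (\<i> * (x - y)) = of_nat (card E) * hom_enum n (shadow T E) x y"
proof -
  have finE: "finite c" if "c \<in> E" for c
  proof (rule finite_subset)
    show "c \<subseteq> T" using that E by (auto simp: binary_code_def)
  qed fact
  have ev: "even (card c)" if "c \<in> E" for c
  proof -
    have "even (card (c \<inter> c))" using E(2) that unfolding dual_sets_def by blast
    then show ?thesis by simp
  qed
  have hom: "even (card (sym_diff a b) div 2) \<longleftrightarrow> (even (card a div 2) \<longleftrightarrow> even (card b div 2))"
    if "a \<in> E" "b \<in> E" for a b
  proof -
    have "even (card (a \<inter> b))" using E(2) that unfolding dual_sets_def by blast
    then obtain r where r: "card (a \<inter> b) = 2 * r" by blast
    have "even (card a)" "even (card b)" using ev that by auto
    then obtain p q where pq: "card a = 2 * p" "card b = 2 * q" by blast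
    have "card (sym_diff a b) + 2 * card (a \<inter> b) = card a + card b"
      using finE that by (intro card_sym_diff)
    then have "card (sym_diff a b) div 2 + 2 * r = p + q" unfolding r pq by linarith
    then have "even (card (sym_diff a b) div 2 + 2 * r) \<longleftrightarrow> even (p + q)" by (rule arg_cong)
    then have "even (card (sym_diff a b) div 2) \<longleftrightarrow> (even p \<longleftrightarrow> even q)"
      unfolding even_add by simp
    then show ?thesis unfolding pq by simp
  qed
  have "hom_enum n E (x + y) (\<i> * (x - y))
      = (\<Sum>c\<in>E. (if even (card c div 2) then 1 else -1) * ((x + y) ^ (n - card c) * (x - y) ^ card c))"
    unfolding hom_enum_def
  proof (intro sum.cong refl)
    fix c assume "c \<in> E"
    then obtain k where k: "card c = 2 * k" using ev by blast
    have "\<i> ^ card c = (\<i>^2) ^ k" unfolding k by (rule power_mult)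
    also have "\<dots> = (if even (card c div 2) then 1 else -1)" by (simp add: k uminus_power_if)
    finally show "(x + y) ^ (n - card c) * (\<i> * (x - y)) ^ card c =
       (if even (card c div 2) then 1 else -1) * ((x + y) ^ (n - card c) * (x - y) ^ card c)"
      by (simp only: power_mult_distrib mult_ac)
  qed
  also have "\<dots> = of_nat (card E) * hom_enum n {v. v \<subseteq> T \<and> (\<forall>c\<in>E. even (card (v \<inter> c)) \<longleftrightarrow> even (card c div 2))} x y"
    by (intro hom_enum_character[OF assms(1-3)] hom)
  finally show ?thesis by (simp only: shadow_def)
qed

lemma hom_enum_homogeneous:
  assumes "E \<subseteq> Pow T" "finite T" "card T = n"
  shows "hom_enum n E (a * x) (a * y) = a ^ n * hom_enum n E x y"
  unfolding hom_enum_def sum_distrib_left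
proof (intro sum.cong refl)
  fix c assume "c \<in> E"
  then have "card c \<le> n" using assms by (auto intro: card_mono)
  then have "a ^ n = a ^ (n - card c) * a ^ card c" by (simp flip: power_add)
  then show "(a * x) ^ (n - card c) * (a * y) ^ card c = a ^ n * (x ^ (n - card c) * y ^ card c)"
    by (simp add: power_mult_distrib)
qed

lemma poly_enum_poly: "poly (enum_poly E) y = hom_enum n E 1 y"
  by (simp add: enum_poly_def hom_enum_def poly_sum poly_monom)

lemma poly_enum_poly_divide:
  assumes "E \<subseteq> Pow T" "finite T" "card T = n" "x \<noteq> 0"
  shows "x ^ n * poly (enum_poly E) (y / x) = hom_enum n E x y"
  using hom_enum_homogeneous[OF assms(1-3), of x 1 "y / x"] assms(4)
  by (simp add: poly_enum_poly[of _ _ n])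

lemma coeff_enum_poly:
  assumes "finite E"
  shows "coeff (enum_poly E) k = of_nat (card {c \<in> E. card c = k})"
proof -
  have "coeff (enum_poly E) k = (\<Sum>c\<in>E. if card c = k then 1 else 0)"
    by (simp add: enum_poly_def coeff_sum)
  also have "\<dots> = (\<Sum>c\<in>{c \<in> E. card c = k}. 1)"
    using assms by (subst sum.inter_filter[symmetric]) auto
  finally show ?thesis by simp
qed

lemma degree_enum_poly:
  assumes "E \<subseteq> Pow T" "finite T"
  shows "degree (enum_poly E) \<le> card T"
  unfolding enum_poly_def
  by (intro degree_sum_le order.trans[OF degree_monom_le] card_mono)
     (use assms in \<open>auto intro: finite_subset\<close>)

lemma pcompose_enum_poly_even:
  assumes "\<And>c. c \<in> E \<Longrightarrow> even (card c)"
  shows "pcompose (enum_poly E) [:0, -1:] = enum_poly E"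
  by (rule poly_eqI_cofinite[of "{}"])
     (auto simp: poly_pcompose enum_poly_def poly_sum poly_monom assms intro!: sum.cong)

text \<open>At x = y = 1 only the zero word contributes to the left side of the MacWilliams
  identity, while the right side counts the dual.\<close>

lemma card_dual_sets:
  fixes T :: "'a set"
  assumes T: "finite T" "card T = n" and E: "binary_code T E"
  shows "card E * card (dual_sets T E) = 2 ^ n"
proof -
  have fin: "finite E" "\<And>c. c \<in> E \<Longrightarrow> finite c"
    using E T by (auto simp: binary_code_def intro: finite_subset)
  have "hom_enum n E 2 0 = (\<Sum>c\<in>{{} :: 'a set}. 2 ^ (n - card c) * 0 ^ card c)"
    unfolding hom_enum_def
    by (rule sum.mono_neutral_right) (use E fin in \<open>auto simp: binary_code_def\<close>)
  then have "hom_enum n E (1 + 1) (1 - 1) = 2 ^ n" by simp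
  then have "2 ^ n = of_nat (card E) * (of_nat (card (dual_sets T E)) :: complex)"
    unfolding macwilliams[OF T E] by (simp add: hom_enum_def)
  then have "of_nat (card E * card (dual_sets T E)) = (of_nat (2 ^ n) :: complex)" by simp
  then show ?thesis unfolding of_nat_eq_iff .
qed

lemma binary_code_dual_sets:
  assumes "finite T"
  shows "binary_code T (dual_sets T E)"
proof -
  have "even (card (sym_diff a b \<inter> c))"
    if "a \<subseteq> T" "b \<subseteq> T" "even (card (a \<inter> c))" "even (card (b \<inter> c))" for a b c
  proof -
    have "sym_diff a b \<inter> c = sym_diff (a \<inter> c) (b \<inter> c)" by auto
    moreover have "finite (a \<inter> c)" "finite (b \<inter> c)" using that assms by (auto intro: finite_subset)
    ultimately have "card (sym_diff a b \<inter> c) + 2 * card ((a \<inter> c) \<inter> (b \<inter> c)) = card (a \<inter> c) + card (b \<inter> c)"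
      using card_sym_diff by metis
    then show ?thesis using that by presburger
  qed
  then show ?thesis by (auto simp: binary_code_def dual_sets_def)
qed

lemma dual_sets_dual_sets:
  assumes T: "finite T" and E: "binary_code T E"
  shows "dual_sets T (dual_sets T E) = E"
proof -
  have sub: "E \<subseteq> dual_sets T (dual_sets T E)"
    using E by (auto simp: dual_sets_def binary_code_def Int_commute)
  have fin: "finite (dual_sets T (dual_sets T E))"
    by (rule finite_subset[of _ "Pow T"]) (use T in \<open>auto simp: dual_sets_def\<close>)
  have "card E * card (dual_sets T E) = card (dual_sets T E) * card (dual_sets T (dual_sets T E))"
    using card_dual_sets[OF T refl E] card_dual_sets[OF T refl binary_code_dual_sets[OF T, of E]] by simp
  moreover have "card (dual_sets T E) \<noteq> 0"
    using card_dual_sets[OF T refl E] by (metis mult_0_right power_not_zero zero_neq_numeral)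
  ultimately have "card E = card (dual_sets T (dual_sets T E))" by simp
  then show ?thesis using card_subset_eq[OF fin sub] by simp
qed

subsection \<open>Extremal codes are doubly even\<close>

lemma fps_nth_inverse_one_minus_X_power:
  "fps_nth (inverse (1 - fX) ^ (a + 1)) p = of_nat ((p + a) choose a)"
proof -
  have "inverse (1 - fX) ^ (a + 1) = inverse ((1 - fps_const 1 * fX) ^ (a + 1))"
    by (subst fps_inverse_power) simp
  then have "fps_nth (inverse (1 - fX) ^ (a + 1)) p = of_nat ((a + 1 + p - 1) choose p)"
    using one_minus_const_fps_X_neg_power'[of "a + 1" "1::complex"] by simp
  also have "(a + 1 + p - 1) choose p = (p + a) choose a"
    using binomial_symmetric[of p "p + a"] by (simp add: add.commute)
  finally show ?thesis .
qed

lemma fps_nth_compose_X2: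
  "fps_nth (f oo fX^2) n = (if even n then fps_nth f (n div 2) else 0)"
proof -
  have "fps_nth (f oo fX^2) n = (\<Sum>i=0..n. if n = 2 * i then fps_nth f i else 0)"
    unfolding fps_compose_nth by (intro sum.cong refl) (auto simp: fps_X_power_nth simp flip: power_mult)
  also have "\<dots> = (\<Sum>i\<in>(if even n then {n div 2} else {}). fps_nth f i)"
  proof (cases "even n")
    case False
    then have "(if n = 2 * i then fps_nth f i else 0) = 0" for i by auto
    then show ?thesis using False by simp
  qed (auto simp: sum.delta elim!: evenE)
  finally show ?thesis by simp
qed

lemma inverse_one_plus_minus_X_power:
  "inverse (1 + fX) ^ a * inverse (1 - fX) ^ a = inverse (1 - fX) ^ a oo fX^2"
proof -
  have "inverse (1 - fX) oo fX^2 = inverse ((1 - fX) oo fX^2)"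
    by (rule fps_inverse_compose) simp_all
  also have "(1 - fX) oo fX^2 = (1 + fX) * (1 - fX)"
    by (simp add: fps_compose_sub_distrib algebra_simps power2_eq_square)
  also have "inverse ((1 + fX) * (1 - fX)) = inverse (1 + fX) * inverse (1 - fX)"
    by (rule fps_inverse_mult)
  finally have u: "inverse (1 - fX) oo fX^2 = inverse (1 + fX) * inverse (1 - fX)" .
  have "inverse (1 - fX) ^ a oo fX^2 = (inverse (1 - fX) oo fX^2) ^ a"
    by (rule fps_compose_power[symmetric]) simp
  then show ?thesis unfolding u power_mult_distrib by simp
qed

text \<open>For \<open>0 < J\<close> this is twice the absolute value of the coefficient of
  (2x)^(2J) in the Chebyshev polynomial of the first kind of degree 2i.\<close>

definition chebyshev_coeff :: "nat \<Rightarrow> nat \<Rightarrow> nat" where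
  "chebyshev_coeff J i = ((i + J) choose (2 * J)) + ((i + J - 1) choose (2 * J))"

lemma chebyshev_coeff_fps:
  assumes "J \<le> i" "0 < J"
  shows "fps_nth ((1 + fX) * inverse (1 - fX) ^ (2 * J + 1)) (i - J) = of_nat (chebyshev_coeff J i)"
proof -
  have "fps_nth ((1 + fX) * inverse (1 - fX) ^ (2 * J + 1)) (i - J)
    = fps_nth (inverse (1 - fX) ^ (2 * J + 1)) (i - J)
      + (if i = J then 0 else fps_nth (inverse (1 - fX) ^ (2 * J + 1)) (i - J - 1))"
    using assms by (auto simp: distrib_right simp del: power_Suc add_Suc_right)
  then show ?thesis using assms
    unfolding fps_nth_inverse_one_minus_X_power chebyshev_coeff_def by (auto simp: mult_2)
qed

lemma chebyshev_coeff_pos: "J \<le> i \<Longrightarrow> 0 < chebyshev_coeff J i"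
  by (simp add: chebyshev_coeff_def)

text \<open>The coefficient recurrence behind the Chebyshev differential equation, derived here by
  absorption of the two binomials.\<close>

lemma chebyshev_coeff_Suc:
  assumes "J \<le> i" "0 < J"
  shows "(2 * int J + 1) * (2 * int J + 2) * int (chebyshev_coeff (J + 1) i)
     = (int i ^ 2 - int J ^ 2) * int (chebyshev_coeff J i)"
proof -
  define x where "x = int ((i + J) choose (2 * J))"
  define y where "y = int ((i + J - 1) choose (2 * J))"
  have xy: "(int i + int J) * y = (int i - int J) * x"
  proof -
    have "(i + J - 2 * J) * ((i + J) choose (2 * J)) = (i + J) * ((i + J - 1) choose (2 * J))"
      by (rule binomial_absorb_comp)
    then have "int ((i + J - 2 * J) * ((i + J) choose (2 * J))) = int ((i + J) * ((i + J - 1) choose (2 * J)))"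
      by simp
    then show ?thesis using assms by (simp add: x_def y_def of_nat_diff)
  qed
  have up: "(int k + 2) * (int k + 1) * int (N choose (k + 2)) = int (N choose k) * (int N - int k) * (int N - int k - 1)"
    for N k
  proof -
    have s: "int (Suc k) * int (N choose Suc k) = (int N - int k) * int (N choose k)" for k
    proof (cases "k \<le> N")
      case True
      have "Suc k * (N choose Suc k) = (N - k) * (N choose k)"
        using binomial_absorption[of k N] binomial_absorb_comp[of N k] by simp
      then have "int (Suc k * (N choose Suc k)) = int ((N - k) * (N choose k))" by (rule arg_cong)
      then show ?thesis using True by (simp only: of_nat_mult of_nat_diff)
    next
      case False
      then have "N < Suc k" by simp
      then have a: "int (N choose Suc k) = 0" by simp
      have b: "(int N - int k) * int (N choose k) = 0" using False by (simp add: binomial_eq_0)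
      show ?thesis unfolding a b by simp
    qed
    have "(int k + 2) * (int k + 1) * int (N choose (k + 2))
      = (int k + 1) * (int (Suc (Suc k)) * int (N choose (Suc (Suc k))))" by simp
    also have "\<dots> = (int N - int (Suc k)) * (int (Suc k) * int (N choose Suc k))"
      unfolding s[of "Suc k"] by (simp add: algebra_simps)
    finally show ?thesis unfolding s[of k] by (simp add: algebra_simps)
  qed
  have a: "(2 * int J + 2) * (2 * int J + 1) * int ((i + J + 1) choose (2 * J + 2)) = (int i + int J + 1) * (int i + int J) * y"
  proof -
    have "Suc (2 * J + 1) * ((i + J + 1) choose Suc (2 * J + 1)) = (i + J + 1) * ((i + J) choose Suc (2 * J))"
      using binomial_absorption[of "2 * J + 1" "i + J + 1"] by simp
    moreover have "Suc (2 * J) * ((i + J) choose Suc (2 * J)) = (i + J) * ((i + J - 1) choose (2 * J))"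
      by (rule binomial_absorption)
    ultimately have "Suc (2 * J) * (Suc (2 * J + 1) * ((i + J + 1) choose Suc (2 * J + 1)))
       = (i + J + 1) * ((i + J) * ((i + J - 1) choose (2 * J)))"
      by (metis mult.left_commute)
    then have "int (Suc (2 * J) * (Suc (2 * J + 1) * ((i + J + 1) choose Suc (2 * J + 1))))
       = int ((i + J + 1) * ((i + J) * ((i + J - 1) choose (2 * J))))" by (rule arg_cong)
    then show ?thesis unfolding y_def by (simp add: algebra_simps)
  qed
  have b: "(2 * int J + 2) * (2 * int J + 1) * int ((i + J) choose (2 * J + 2)) = x * (int i - int J) * (int i - int J - 1)"
    using up[of "2 * J" "i + J"] by (simp add: x_def)
  have "(2 * int J + 1) * (2 * int J + 2) * int (chebyshev_coeff (J + 1) i)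
    = (int i + int J + 1) * (int i + int J) * y + x * (int i - int J) * (int i - int J - 1)"
    unfolding a[symmetric] b[symmetric] chebyshev_coeff_def by (simp add: algebra_simps)
  also have "\<dots> = (int i ^ 2 - int J ^ 2) * (x + y)"
    using xy by algebra
  finally show ?thesis by (simp add: chebyshev_coeff_def x_def y_def)
qed


text \<open>With \<open>B l\<close> the number of shadow vectors of weight \<open>4l\<close>, the relations for \<open>J = 2m\<close> and
  \<open>J = 2m + 1\<close> say that the two sums agree with those for a shadow whose only vector of weight at
  most \<open>4m\<close> is 0. By \<open>chebyshev_coeff_Suc\<close> their combination has weights \<open>(3m)\<^sup>2 - (3m - l)\<^sup>2\<close>, positive for \<open>l > 0\<close>.\<close>

lemma extremal_doubly_even:
  fixes C :: "'a set set"
  assumes T: "finite T" "card T = 24 * m" and m: "m \<ge> 1"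
    and C: "binary_code T C" "dual_sets T C = C"
    and dist: "\<And>c. c \<in> C \<Longrightarrow> c \<noteq> {} \<Longrightarrow> 4 * m + 4 \<le> card c"
    and c: "c \<in> C"
  shows "4 dvd card c"
proof -
  have CT: "C \<subseteq> Pow T" using C by (simp add: binary_code_def)
  have fin: "finite C" "\<And>c. c \<in> C \<Longrightarrow> finite c"
    using CT T by (auto intro: finite_subset)
  have evC: "even (card c)" if "c \<in> C" for c
  proof -
    have "even (card (c \<inter> c))" using C(2) that unfolding dual_sets_def by blast
    then show ?thesis by simp
  qed
  have "(card C)^2 = (2 ^ (12 * m))^2"
    using card_dual_sets[OF T C(1)] unfolding C(2) by (simp add: power2_eq_square flip: power_add)
  then have cardC: "card C = 2 ^ (12 * m)" using power2_eq_imp_eq by blast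
  define p where "p = enum_poly C"
  have inv: "tau_inv 1 (12 * m) p" unfolding tau_inv_def
  proof (intro conjI allI impI)
    show "degree p \<le> 2 * (12 * m)" using degree_enum_poly[OF CT T(1)] T(2) by (simp add: p_def)
    show "pcompose p [:0, -1:] = p" unfolding p_def by (rule pcompose_enum_poly_even) (rule evC)
    fix y :: complex assume "y \<notin> {0,1,-1}"
    then have "1 + y \<noteq> 0" by (auto simp: add_eq_0_iff)
    then have "(1 + y) ^ (24 * m) * poly p ((1 - y) / (1 + y)) = hom_enum (24 * m) C (1 + y) (1 - y)"
      unfolding p_def by (rule poly_enum_poly_divide[OF CT T])
    also have "\<dots> = 2 ^ (12 * m) * poly p y"
      unfolding macwilliams[OF T C(1)] C(2) cardC p_def poly_enum_poly[of C y "24 * m"] by simp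
    finally show "(1 + y) ^ (2 * (12 * m)) * poly p ((1 - y) / (1 + y)) = 1 * 2 ^ (12 * m) * poly p y"
      by simp
  qed
  define S where "S = shadow T C"
  have finS: "finite S"
    by (rule finite_subset[of _ "Pow T"]) (use T in \<open>auto simp: S_def shadow_def\<close>)
  have Q: "2 ^ (12 * m) * poly (enum_poly S) y = (1 + y) ^ (2 * (12 * m)) * poly p (\<i> * (1 - y) / (1 + y))"
    if "y \<notin> {0,1,-1}" for y
  proof -
    have "1 + y \<noteq> 0" using that by (auto simp: add_eq_0_iff)
    then have "(1 + y) ^ (24 * m) * poly p (\<i> * (1 - y) / (1 + y)) = hom_enum (24 * m) C (1 + y) (\<i> * (1 - y))"
      unfolding p_def by (rule poly_enum_poly_divide[OF CT T])
    also have "\<dots> = 2 ^ (12 * m) * poly (enum_poly S) y"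
      using hom_enum_shadow[OF T C(1), of 1 y] C(2) unfolding S_def cardC poly_enum_poly[of _ y "24 * m"] by simp
    finally show ?thesis by simp
  qed
  have p0: "coeff p 0 = 1"
  proof -
    have "{c \<in> C. card c = 0} = {{}}" using fin C(1) by (auto simp: binary_code_def)
    then show ?thesis unfolding p_def coeff_enum_poly[OF fin(1)] by simp
  qed
  \<comment> \<open>The bound 4m + 4 kills the weights 2, ..., 4m + 2, just enough for both J = 2m
    and J = 2m + 1.\<close>
  have low: "coeff p (2 * k) = 0" if "k \<in> {1..2 * m + 1}" for k
  proof -
    have "{c \<in> C. card c = 2 * k} = {}" using dist that by force
    then show ?thesis unfolding p_def coeff_enum_poly[OF fin(1)] by (simp only: card.empty of_nat_0)
  qed
  define B where "B l = card {v \<in> S. card v = 4 * l}" for l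
  define F where "F J = fps_nth ((1 - 6 * fX + fX^2) * inverse (1 + fX) ^ (12 * m + 1 - 4 * J)
            * inverse (1 - fX) ^ (2 * J + 1)) J" for J
  have main: "2 ^ (12 * m) * (\<Sum>l\<le>3 * m - J. of_nat (B l * chebyshev_coeff J (3 * m - l)))
       = 4 ^ (12 * m - 4 * J) * (-4) ^ J * F J" if J: "0 < J" "J \<le> 2 * m + 1" for J
  proof -
    have J3: "J \<le> 3 * m" using J m by linarith
    have "2 ^ (12 * m) * (\<Sum>l\<le>(12 * m) div 4 - J. coeff (enum_poly S) ((12 * m) mod 4 + 4 * l) *
             fps_nth ((if (0::nat) = 0 then 1 + fX else 1) * inverse (1 - fX) ^ (2 * J + 1)) ((12 * m) div 4 - J - l))
       = (if (0::nat) = 0 then 1 else 8) * 4 ^ (12 * m - 4 * J) * (-4) ^ J * coeff p 0 *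
         fps_nth ((if (0::nat) = 0 then 1 - 6 * fX + fX^2 else 1) * inverse (1 + fX) ^ (12 * m + 1 - 4 * J)
            * inverse (1 - fX) ^ (2 * J + 1)) J"
    proof (rule enumerator_identity[of 1 1 0 "12 * m" p])
      show "sign_factor 1 1 0" by (simp add: sign_factor_def)
      show "coeff p (2 * k) = 0" if "k \<in> {1..J}" for k
        using low that J by simp
      show "4 * J \<le> 12 * m" using J3 by simp
    qed (use inv Q in auto)
    moreover have "(\<Sum>l\<le>(12 * m) div 4 - J. coeff (enum_poly S) ((12 * m) mod 4 + 4 * l) *
             fps_nth ((if (0::nat) = 0 then 1 + fX else 1) * inverse (1 - fX) ^ (2 * J + 1)) ((12 * m) div 4 - J - l))
       = (\<Sum>l\<le>3 * m - J. of_nat (B l * chebyshev_coeff J (3 * m - l)))"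
    proof (intro sum.cong)
      fix l assume "l \<in> {..3 * m - J}"
      then have l: "J \<le> 3 * m - l" using J3 by auto
      have "(12 * m) div 4 - J - l = 3 * m - l - J" by simp
      then show "coeff (enum_poly S) ((12 * m) mod 4 + 4 * l) *
             fps_nth ((if (0::nat) = 0 then 1 + fX else 1) * inverse (1 - fX) ^ (2 * J + 1)) ((12 * m) div 4 - J - l)
         = of_nat (B l * chebyshev_coeff J (3 * m - l))"
        using chebyshev_coeff_fps[OF l J(1)] coeff_enum_poly[OF finS] by (simp add: B_def del: power_Suc)
    qed simp
    ultimately show ?thesis using p0 by (simp add: F_def del: power_Suc)
  qed
  \<comment> \<open>At J = 2m both inverse powers have exponent 4m + 1, so their product is a series
    in X^2. The term -6X only affects odd degrees, hence not degree 2m.\<close>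
  have F1: "F (2 * m) = of_nat (chebyshev_coeff (2 * m) (3 * m))"
  proof -
    define f where "f = inverse (1 - fX) ^ (4 * m + 1)"
    have e: "12 * m + 1 - 4 * (2 * m) = 4 * m + 1" "2 * (2 * m) + 1 = 4 * m + 1" by simp_all
    have "(1 - 6 * fX + fX^2) * inverse (1 + fX) ^ (4 * m + 1) * inverse (1 - fX) ^ (4 * m + 1)
       = (1 + fX^2 - 6 * fX) * (f oo fX^2)"
      unfolding f_def inverse_one_plus_minus_X_power[symmetric] by (simp add: algebra_simps)
    also have "\<dots> = (((1 + fX) * f) oo fX^2) + fX * (((-6) * f) oo fX^2)"
      by (simp add: fps_compose_mult_distrib fps_compose_add_distrib fps_compose_uminus algebra_simps
          )
    finally have "F (2 * m) = fps_nth (((1 + fX) * f) oo fX^2) (2 * m) + fps_nth (fX * (((-6) * f) oo fX^2)) (2 * m)"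
      unfolding F_def e by simp
    also have "fps_nth (fX * (((-6) * f) oo fX^2)) (2 * m) = 0"
      using m by (simp add: fps_nth_compose_X2)
    also have "fps_nth (((1 + fX) * f) oo fX^2) (2 * m) = fps_nth ((1 + fX) * inverse (1 - fX) ^ (2 * (2 * m) + 1)) (3 * m - 2 * m)"
      by (simp add: fps_nth_compose_X2 f_def del: power_Suc)
    finally show ?thesis using chebyshev_coeff_fps[of "2 * m" "3 * m"] m by simp
  qed
  have F2: "F (2 * m + 1) = -64 * of_nat (chebyshev_coeff (2 * m + 1) (3 * m))"
  proof -
    define f where "f = inverse (1 - fX) ^ (4 * m + 3)"
    have e: "12 * m + 1 - 4 * (2 * m + 1) = 4 * m - 3" "2 * (2 * m + 1) + 1 = 4 * m + 3" by simp_all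
    \<comment> \<open>The factor (1 + X)^6 balances the exponents 4m - 3 and 4m + 3. Degree 2m + 1
      is odd, so only the odd part -64 X^3 (1 + X^2) of the new numerator matters.\<close>
    have e6: "(1 + fX) ^ 6 * inverse (1 + fX) ^ (4 * m + 3) = inverse (1 + fX) ^ (4 * m - 3)"
      using power_mult_inverse_power(1)[OF inverse_one_minus_X(3), of 6 "4 * m + 3"] m by simp
    have "(1 - 6 * fX + fX^2) * inverse (1 + fX) ^ (4 * m - 3) * inverse (1 - fX) ^ (4 * m + 3)
      = (1 - 6 * fX + fX^2) * (1 + fX) ^ 6 * (inverse (1 + fX) ^ (4 * m + 3) * inverse (1 - fX) ^ (4 * m + 3))"
      unfolding e6[symmetric] by (simp only: mult_ac)
    also have "(1 - 6 * fX + fX^2) * (1 + fX) ^ 6 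
      = (1 - 20 * fX^2 - 90 * fX^4 - 20 * fX^6 + fX^8) + fX * (-64 * fX^2 * (1 + fX^2))"
      by algebra
    also have "\<dots> = ((1 - 20 * fX - 90 * fX^2 - 20 * fX^3 + fX^4) oo fX^2) + fX * ((-64 * fX * (1 + fX)) oo fX^2)"
      by (simp add: fps_compose_mult_distrib fps_compose_add_distrib fps_compose_sub_distrib fps_compose_uminus
           fps_compose_power[symmetric] flip: power_mult)
    also have "inverse (1 + fX) ^ (4 * m + 3) * inverse (1 - fX) ^ (4 * m + 3) = f oo fX^2"
      unfolding f_def by (rule inverse_one_plus_minus_X_power)
    also have "(((1 - 20 * fX - 90 * fX^2 - 20 * fX^3 + fX^4) oo fX^2) + fX * ((-64 * fX * (1 + fX)) oo fX^2)) * (f oo fX^2)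
       = (((1 - 20 * fX - 90 * fX^2 - 20 * fX^3 + fX^4) * f) oo fX^2) + fX * ((-64 * (fX * ((1 + fX) * f))) oo fX^2)"
    proof -
      have "-64 * (fX * ((1 + fX) * f)) = (-64 * fX * (1 + fX)) * f" by (simp only: mult.assoc)
      moreover have "(a * f) oo fX^2 = (a oo fX^2) * (f oo fX^2)" for a
        by (rule fps_compose_mult_distrib) simp
      ultimately show ?thesis by (simp only: distrib_right[of _ _ "f oo fX^2"] mult.assoc[of _ _ "f oo fX^2"])
    qed
    finally have "F (2 * m + 1) = fps_nth (((1 - 20 * fX - 90 * fX^2 - 20 * fX^3 + fX^4) * f) oo fX^2) (2 * m + 1) 
       + fps_nth (fX * ((-64 * (fX * ((1 + fX) * f))) oo fX^2)) (2 * m + 1)"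
      unfolding F_def e by simp
    also have "fps_nth (((1 - 20 * fX - 90 * fX^2 - 20 * fX^3 + fX^4) * f) oo fX^2) (2 * m + 1) = 0"
      by (simp add: fps_nth_compose_X2)
    also have "fps_nth (fX * ((-64 * (fX * ((1 + fX) * f))) oo fX^2)) (2 * m + 1) = fps_nth (-64 * (fX * ((1 + fX) * f))) m"
      by (simp add: fps_nth_compose_X2)
    also have "\<dots> = -64 * fps_nth ((1 + fX) * f) (m - 1)"
    proof -
      have "-64 * (fX * ((1 + fX) * f)) = fps_const (-64) * (fX * ((1 + fX) * f))"
        by (simp add: numeral_fps_const flip: fps_const_neg)
      then show ?thesis using m by (simp only: fps_mult_left_const_nth fps_X_mult_nth) simp
    qed
    also have "m - 1 = 3 * m - (2 * m + 1)" using m by simp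
    finally show ?thesis using chebyshev_coeff_fps[of "2 * m + 1" "3 * m"] m unfolding f_def e(2)[symmetric] by simp
  qed
  have eq1: "(\<Sum>l\<le>m. B l * chebyshev_coeff (2 * m) (3 * m - l)) = chebyshev_coeff (2 * m) (3 * m)"
  proof -
    have "(4::complex) ^ (12 * m - 4 * (2 * m)) * (-4) ^ (2 * m) = 2 ^ (12 * m)"
    proof -
      have "(4::complex) ^ (12 * m - 4 * (2 * m)) * (-4) ^ (2 * m) = 4 ^ (4 * m + 2 * m)"
        unfolding power_add by simp
      also have "\<dots> = (2 ^ 2) ^ (6 * m)" by simp
      also have "\<dots> = 2 ^ (12 * m)" unfolding power_mult[symmetric] by simp
      finally show ?thesis .
    qed
    then have "of_nat (\<Sum>l\<le>m. B l * chebyshev_coeff (2 * m) (3 * m - l)) = (of_nat (chebyshev_coeff (2 * m) (3 * m)) :: complex)"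
      using main[of "2 * m"] m unfolding F1 by simp
    then show ?thesis unfolding of_nat_eq_iff .
  qed
  have eq2: "(\<Sum>l\<le>m - 1. B l * chebyshev_coeff (2 * m + 1) (3 * m - l)) = chebyshev_coeff (2 * m + 1) (3 * m)"
  proof -
    have "(4::complex) ^ (12 * m - 4 * (2 * m + 1)) * (-4) ^ (2 * m + 1) * -64 = 2 ^ (12 * m)"
    proof -
      have e1: "12 * m - 4 * (2 * m + 1) = 4 * (m - 1)" using m by simp
      have e2: "2 * m + 1 = 2 * (m - 1) + 3" using m by simp
      have "(4::complex) ^ (12 * m - 4 * (2 * m + 1)) * (-4) ^ (2 * m + 1) * -64 = 4 ^ (4 * (m - 1) + 2 * (m - 1) + 6)"
        unfolding e1 unfolding e2 power_add by simp
      also have "4 * (m - 1) + 2 * (m - 1) + 6 = 6 * m" using m by simp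
      also have "(4::complex) ^ (6 * m) = (2 ^ 2) ^ (6 * m)" by simp
      also have "\<dots> = 2 ^ (12 * m)" unfolding power_mult[symmetric] by simp
      finally show ?thesis .
    qed
    moreover have "3 * m - (2 * m + 1) = m - 1" by simp
    ultimately have "of_nat (\<Sum>l\<le>m - 1. B l * chebyshev_coeff (2 * m + 1) (3 * m - l)) = (of_nat (chebyshev_coeff (2 * m + 1) (3 * m)) :: complex)"
      using main[of "2 * m + 1"] m unfolding F2 by (simp del: power_Suc add: mult.assoc[symmetric])
    then show ?thesis unfolding of_nat_eq_iff .
  qed
  have zero: "(\<Sum>l\<le>m. int (B l) * int (chebyshev_coeff (2 * m) (3 * m - l)) * (int (3 * m)^2 - int (3 * m - l)^2)) = 0"
  proof -
    let ?k = "(2 * int (2 * m) + 1) * (2 * int (2 * m) + 2)"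
    have "?k * int (chebyshev_coeff (2 * m + 1) (3 * m))
      = ?k * (\<Sum>l\<le>m - 1. int (B l) * int (chebyshev_coeff (2 * m + 1) (3 * m - l)))"
      unfolding eq2[symmetric] by simp
    also have "\<dots> = (\<Sum>l\<le>m - 1. int (B l) * (?k * int (chebyshev_coeff (2 * m + 1) (3 * m - l))))"
      by (simp only: sum_distrib_left mult_ac)
    also have "\<dots> = (\<Sum>l\<le>m - 1. int (B l) * ((int (3 * m - l)^2 - int (2 * m)^2) * int (chebyshev_coeff (2 * m) (3 * m - l))))"
      by (intro sum.cong refl) (use m in \<open>subst chebyshev_coeff_Suc, auto\<close>)
    \<comment> \<open>The added term l = m vanishes because 3m - l = 2m there.\<close>
    also have "\<dots> = (\<Sum>l\<le>m. int (B l) * ((int (3 * m - l)^2 - int (2 * m)^2) * int (chebyshev_coeff (2 * m) (3 * m - l))))"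
    proof (rule sum.mono_neutral_left)
      have "l = m" if "l \<in> {..m} - {..m - 1}" for l using that by auto
      moreover have "3 * m - m = 2 * m" by simp
      ultimately show "\<forall>l\<in>{..m} - {..m - 1}. int (B l) * ((int (3 * m - l)^2 - int (2 * m)^2) * int (chebyshev_coeff (2 * m) (3 * m - l))) = 0"
        by (metis cancel_comm_monoid_add_class.diff_cancel mult_zero_left mult_zero_right)
    qed auto
    finally have "?k * int (chebyshev_coeff (2 * m + 1) (3 * m)) = \<dots>" .
    moreover have "?k * int (chebyshev_coeff (2 * m + 1) (3 * m))
       = (int (3 * m)^2 - int (2 * m)^2) * (\<Sum>l\<le>m. int (B l) * int (chebyshev_coeff (2 * m) (3 * m - l)))"
      using chebyshev_coeff_Suc[of "2 * m" "3 * m"] m arg_cong[OF eq1, of int] by simp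
    ultimately have "(\<Sum>l\<le>m. (int (3 * m)^2 - int (2 * m)^2) * (int (B l) * int (chebyshev_coeff (2 * m) (3 * m - l))) -
      int (B l) * ((int (3 * m - l)^2 - int (2 * m)^2) * int (chebyshev_coeff (2 * m) (3 * m - l)))) = 0"
      by (simp only: sum_subtractf sum_distrib_left)
    moreover have "(u - v) * (b * x) - b * ((w - v) * x) = b * x * (u - w)" for u v w b x :: int
      by (simp add: algebra_simps)
    ultimately show ?thesis by (simp only:)
  qed
  have B0: "B l = 0" if l: "1 \<le> l" "l \<le> m" for l
  proof -
    have sq: "int (3 * m - k)^2 \<le> int (3 * m)^2" for k
      by (intro power_mono) auto
    have "\<forall>l\<in>{..m}. int (B l) * int (chebyshev_coeff (2 * m) (3 * m - l)) * (int (3 * m)^2 - int (3 * m - l)^2) = 0"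
    proof (subst sum_nonneg_eq_0_iff[symmetric])
      show "0 \<le> int (B k) * int (chebyshev_coeff (2 * m) (3 * m - k)) * (int (3 * m)^2 - int (3 * m - k)^2)" for k
        by (intro mult_nonneg_nonneg of_nat_0_le_iff) (simp only: diff_ge_0_iff_ge sq)
    qed (use zero in auto)
    then have "int (B l) * int (chebyshev_coeff (2 * m) (3 * m - l)) * (int (3 * m)^2 - int (3 * m - l)^2) = 0"
      using l by simp
    moreover have "0 < chebyshev_coeff (2 * m) (3 * m - l)" using l by (intro chebyshev_coeff_pos) simp
    moreover have "int (3 * m - l)^2 < int (3 * m)^2" using l by (intro power_strict_mono) auto
    ultimately show ?thesis by simp
  qed
  have "(\<Sum>l\<le>m. B l * chebyshev_coeff (2 * m) (3 * m - l)) = (\<Sum>l\<in>{0}. B l * chebyshev_coeff (2 * m) (3 * m - l))"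
    by (rule sum.mono_neutral_right) (use B0 in auto)
  \<comment> \<open>The zero vector lies in the shadow, and this says that half of every weight is
    even.\<close>
  then have "B 0 \<noteq> 0" using eq1 chebyshev_coeff_pos[of "2 * m" "3 * m"] by auto
  then have "{v \<in> S. card v = 0} \<noteq> {}" unfolding B_def by force
  then obtain v where "v \<in> S" "card v = 0" by blast
  then have "finite v" using T(1) by (auto simp: S_def shadow_def intro: finite_subset)
  then have "{} \<in> S" using \<open>v \<in> S\<close> \<open>card v = 0\<close> by simp
  then have "even (card {} :: nat) \<longleftrightarrow> even (card c div 2)" using c unfolding S_def shadow_def by auto
  then have "even (card c div 2)" by simp
  moreover have "even (card c)" by (rule evC[OF c])
  ultimately show ?thesis by (auto elim!: evenE)
qed

subsection \<open>Even codes containing their dual\<close>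

text \<open>By absorption the first binomial is five copies of the right-hand one, and the second is
  one more copy. The factor 6 contains 2 only once, which the later parity argument needs.\<close>

lemma binomial_5_sum:
  assumes "\<mu> > 0"
  shows "chebyshev_coeff (2 * \<mu>) (\<mu> + 2 * \<mu>) = 6 * ((5 * \<mu> - 1) choose (\<mu> - 1))"
proof -
  have "\<mu> * ((5 * \<mu>) choose \<mu>) = \<mu> * (5 * ((5 * \<mu> - 1) choose (\<mu> - 1)))"
    using times_binomial_minus1_eq[OF assms, of "5 * \<mu>"] by (simp only: mult_ac)
  then have "(5 * \<mu>) choose \<mu> = 5 * ((5 * \<mu> - 1) choose (\<mu> - 1))" using assms by simp
  moreover have "(5 * \<mu>) choose (4 * \<mu>) = (5 * \<mu>) choose \<mu>"
    using binomial_symmetric[of "4 * \<mu>" "5 * \<mu>"] by simp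
  moreover have "(5 * \<mu> - 1) choose (4 * \<mu>) = (5 * \<mu> - 1) choose (\<mu> - 1)"
  proof -
    have "5 * \<mu> - 1 - 4 * \<mu> = \<mu> - 1" using assms by simp
    then show ?thesis using binomial_symmetric[of "4 * \<mu>" "5 * \<mu> - 1"] assms by simp
  qed
  moreover have "\<mu> + 2 * \<mu> + 2 * \<mu> = 5 * \<mu>" "2 * (2 * \<mu>) = 4 * \<mu>" by simp_all
  ultimately show ?thesis unfolding chebyshev_coeff_def by (simp only:)
qed

lemma one_plus_i_power: "(1 + \<i>) ^ (12 * m) = 2 ^ (6 * m) * (-1) ^ m"
proof -
  have "(1 + \<i>) ^ (12 * m) = ((1 + \<i>)^2) ^ (6 * m)" unfolding power_mult[symmetric] by simp
  also have "(1 + \<i>)^2 = 2 * \<i>" by (simp add: power2_eq_square algebra_simps)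
  also have "(2 * \<i>) ^ (6 * m) = 2 ^ (6 * m) * (\<i> ^ 6) ^ m"
    unfolding power_mult_distrib power_mult by simp
  also have "\<i> ^ 6 = -1" by (simp add: eval_nat_numeral)
  finally show ?thesis .
qed

text \<open>Extracting (1 + X)^2 = (1 + X^2) + 2X balances the exponents and leaves a series in X^2;
  the parity of \<open>m\<close> decides which part contributes.\<close>

lemma shadow_lagrange_coeff:
  assumes "m \<ge> 1"
  shows "fps_nth (inverse (1 + fX) ^ (2 * m - 1) * inverse (1 - fX) ^ (2 * m + 1)) m =
    of_nat (if even m then chebyshev_coeff m (m div 2 + m) else 2 * ((m div 2 + 2 * m) choose (2 * m)))"
proof -
  define f where "f = inverse (1 - fX) ^ (2 * m + 1)"
  have e: "(1 + fX) ^ 2 * inverse (1 + fX) ^ (2 * m + 1) = inverse (1 + fX) ^ (2 * m - 1)"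
    using power_mult_inverse_power(1)[OF inverse_one_minus_X(3), of 2 "2 * m + 1"] assms by simp
  have "inverse (1 + fX) ^ (2 * m - 1) * inverse (1 - fX) ^ (2 * m + 1)
    = (1 + fX) ^ 2 * (inverse (1 + fX) ^ (2 * m + 1) * inverse (1 - fX) ^ (2 * m + 1))"
    unfolding e[symmetric] by (simp only: mult_ac)
  also have "\<dots> = (1 + fX) ^ 2 * (f oo fX^2)"
    unfolding f_def inverse_one_plus_minus_X_power ..
  also have "(1 + fX) ^ 2 = ((1 + fX) oo fX^2) + fX * (2 oo fX^2)"
    by (simp add: fps_compose_add_distrib power2_eq_square algebra_simps)
  also have "(((1 + fX) oo fX^2) + fX * (2 oo fX^2)) * (f oo fX^2)
     = (((1 + fX) * f) oo fX^2) + fX * ((2 * f) oo fX^2)"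
  proof -
    have "(a * f) oo fX^2 = (a oo fX^2) * (f oo fX^2)" for a
      by (rule fps_compose_mult_distrib) simp
    then show ?thesis by (simp only: distrib_right[of _ _ "f oo fX^2"] mult.assoc[of _ _ "f oo fX^2"])
  qed
  finally have *: "fps_nth (inverse (1 + fX) ^ (2 * m - 1) * inverse (1 - fX) ^ (2 * m + 1)) m
    = fps_nth (((1 + fX) * f) oo fX^2) m + fps_nth ((2 * f) oo fX^2) (m - 1)"
    using assms by simp
  have 2: "2 * f = fps_const 2 * f" by (simp add: numeral_fps_const)
  show ?thesis
  proof (cases "even m")
    case True
    then have "odd (m - 1)" using assms by simp
    then show ?thesis using chebyshev_coeff_fps[of m "m div 2 + m"] True assms
      unfolding * by (simp add: fps_nth_compose_X2 f_def del: power_Suc)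
  next
    case False
    then have "even (m - 1)" "(m - 1) div 2 = m div 2" by presburger+
    then show ?thesis using False fps_nth_inverse_one_minus_X_power[of "2 * m" "m div 2"]
      unfolding * 2 by (simp add: fps_nth_compose_X2 f_def del: power_Suc)
  qed
qed

lemma even_dual_self_dual:
  fixes E :: "'a set set"
  assumes T: "finite T" "card T = 12 * m" and m: "m \<ge> 1"
    and E: "binary_code T E" "E \<subseteq> dual_sets T E"
    and dist: "\<And>b. b \<in> dual_sets T E \<Longrightarrow> b \<noteq> {} \<Longrightarrow> 2 * m + 2 \<le> card b"
    and ev: "\<And>b. b \<in> dual_sets T E \<Longrightarrow> even (card b)"
    and par: "odd m \<or> (\<exists>\<mu>. m = 2 * \<mu> \<and> odd ((5 * \<mu> - 1) choose (\<mu> - 1)))"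
  shows "dual_sets T E = E"
proof (rule ccontr)
  define B where "B = dual_sets T E"
  assume "dual_sets T E \<noteq> E"
  then have psub: "E \<subset> B" using E(2) by (auto simp: B_def)
  have B: "binary_code T B" unfolding B_def by (rule binary_code_dual_sets[OF T(1)])
  have dB: "dual_sets T B = E" unfolding B_def by (rule dual_sets_dual_sets[OF T(1) E(1)])
  have BT: "B \<subseteq> Pow T" "E \<subseteq> Pow T" using B E(1) by (simp_all add: binary_code_def)
  have finB: "finite B" "finite E" using BT T by (auto intro: finite_subset)
  have evB: "even (card b)" if "b \<in> B" for b using ev that by (simp add: B_def)
  have evE: "even (card b)" if "b \<in> E" for b using evB that psub by blast
  have cEB: "card E * card B = 2 ^ (12 * m)"
    using card_dual_sets[OF T E(1)] by (simp add: B_def)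
  obtain e where e: "e \<le> 12 * m" "card E = 2 ^ e"
    using cEB divides_primepow_nat[of 2 "card E" "12 * m"] by (metis dvd_triv_left two_is_prime_nat)
  have cB: "card B = 2 ^ (12 * m - e)"
  proof -
    have "2 ^ e * card B = 2 ^ e * 2 ^ (12 * m - e)" using cEB e by (simp flip: power_add)
    then show ?thesis by simp
  qed
  have "card E < card B" by (rule psubset_card_mono[OF finB(1) psub])
  then have "e < 12 * m - e" unfolding e cB by (simp add: power_strict_increasing_iff)
  then have e6: "e < 6 * m" by simp
  \<comment> \<open>Since |E| |B| = 2^(12m), this number is both 2^(6m) / |E| and |B| / 2^(6m).
    Hence the MacWilliams transform exchanges the two terms of \<open>p\<close> below up to the
    factor 2^(6m), and their difference changes sign.\<close>
  define \<kappa> :: nat where "\<kappa> = 2 ^ (6 * m - e)"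
  have \<kappa>: "even \<kappa>" "2 \<le> \<kappa>"
  proof -
    obtain d where "6 * m - e = Suc d" using e6 by (metis Suc_diff_Suc)
    then show "even \<kappa>" "2 \<le> \<kappa>" by (simp_all add: \<kappa>_def)
  qed
  have \<kappa>E: "\<kappa> * card E = 2 ^ (6 * m)" using e6 by (simp add: \<kappa>_def e flip: power_add)
  have \<kappa>B: "card B = 2 ^ (6 * m) * \<kappa>" using e6 by (simp add: \<kappa>_def cB flip: power_add)
  have \<kappa>E': "of_nat \<kappa> * of_nat (card E) = (2 ^ (6 * m) :: complex)"
    using arg_cong[OF \<kappa>E, of of_nat] by simp
  \<comment> \<open>The all-ones word is orthogonal to all words of even weight. Once it lies in
    \<open>E\<close>, testing against it shows that shadow words have even weight.\<close>
  have "T \<in> dual_sets T B" using evB BT by (auto simp: dual_sets_def Int_absorb1)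
  then have TE: "T \<in> E" unfolding dB .

  note mB = macwilliams[OF T B, unfolded dB]
  note mE = macwilliams[OF T E(1), folded B_def]
  define p where "p = enum_poly B - smult (of_nat \<kappa>) (enum_poly E)"
  have p_div: "(1 + y) ^ (12 * m) * poly p (z / (1 + y))
      = hom_enum (12 * m) B (1 + y) z - of_nat \<kappa> * hom_enum (12 * m) E (1 + y) z" if "1 + y \<noteq> 0" for y z
    unfolding p_def
    using poly_enum_poly_divide[OF BT(1) T that, of z] poly_enum_poly_divide[OF BT(2) T that, of z]
    by (simp add: algebra_simps)
  have inv: "tau_inv (-1) (6 * m) p" unfolding tau_inv_def
  proof (intro conjI allI impI)
    show "degree p \<le> 2 * (6 * m)" unfolding p_def
      using degree_enum_poly[OF BT(1) T(1)] degree_enum_poly[OF BT(2) T(1)] T(2)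
      by (intro degree_diff_le order.trans[OF degree_smult_le]) auto
    show "pcompose p [:0, -1:] = p" unfolding p_def pcompose_diff pcompose_smult
      using pcompose_enum_poly_even[of B] pcompose_enum_poly_even[of E] evB evE by simp
    fix y :: complex assume "y \<notin> {0,1,-1}"
    then have "1 + y \<noteq> 0" by (auto simp: add_eq_0_iff)
    have "(1 + y) ^ (12 * m) * poly p ((1 - y) / (1 + y))
      = of_nat (card B) * hom_enum (12 * m) E 1 y - of_nat \<kappa> * (of_nat (card E) * hom_enum (12 * m) B 1 y)"
      unfolding p_div[OF \<open>1 + y \<noteq> 0\<close>] mB mE ..
    also have "\<dots> = - (2 ^ (6 * m) * (hom_enum (12 * m) B 1 y - of_nat \<kappa> * hom_enum (12 * m) E 1 y))"
      unfolding mult.assoc[symmetric] \<kappa>E' unfolding \<kappa>B by (simp add: algebra_simps)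
    also have "hom_enum (12 * m) B 1 y - of_nat \<kappa> * hom_enum (12 * m) E 1 y = poly p y"
      by (simp add: p_def poly_enum_poly[of _ y "12 * m"])
    finally show "(1 + y) ^ (2 * (6 * m)) * poly p ((1 - y) / (1 + y)) = -1 * 2 ^ (6 * m) * poly p y"
      by simp
  qed
  have coeff_p: "coeff p k = of_nat (card {b \<in> B. card b = k}) - of_nat \<kappa> * of_nat (card {b \<in> E. card b = k})" for k
    unfolding p_def using coeff_enum_poly[OF finB(1), of k] coeff_enum_poly[OF finB(2), of k] by simp
  have p0: "coeff p 0 = 1 - of_nat \<kappa>"
  proof -
    have "finite b" if "b \<in> B" for b using that BT T by (auto intro: finite_subset)
    then have "{b \<in> B. card b = 0} = {{}}" "{b \<in> E. card b = 0} = {{}}"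
      using B E(1) psub by (auto simp: binary_code_def)
    then show ?thesis unfolding coeff_p by simp
  qed
  have low: "coeff p (2 * k) = 0" if "k \<in> {1..m}" for k
  proof -
    have "{b \<in> B. card b = 2 * k} = {}" using dist that unfolding B_def by force
    moreover from this have "{b \<in> E. card b = 2 * k} = {}" using psub by blast
    ultimately show ?thesis unfolding coeff_p by (simp only: card.empty of_nat_0) simp
  qed

  define S where "S = shadow T E"
  have finS: "finite S"
    by (rule finite_subset[of _ "Pow T"]) (use T in \<open>auto simp: S_def shadow_def\<close>)
  have evS: "even (card v)" if "v \<in> S" for v
  proof -
    have "v \<subseteq> T" and "even (card (v \<inter> T)) \<longleftrightarrow> even (card T div 2)"
      using that TE unfolding S_def shadow_def by blast+
    then show ?thesis by (simp add: Int_absorb2 T(2))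
  qed
  \<comment> \<open>The transforms of W_B and of \<kappa> W_E are both given by \<open>S\<close>,
    evaluated at -iy and at y. The contributions of v cancel unless |v|/2 + m is odd, when they add
    up.\<close>
  define R where "R = {v \<in> S. odd (card v div 2 + m)}"
  have finR: "finite R" using finS by (simp add: R_def)
  have Q: "- (2 * 2 ^ (6 * m)) * poly (enum_poly R) y = (1 + y) ^ (2 * (6 * m)) * poly p (\<i> * (1 - y) / (1 + y))"
    if y: "y \<notin> {0,1,-1}" for y
  proof -
    have y1: "1 + y \<noteq> 0" using y by (auto simp: add_eq_0_iff)
    have "of_nat (card E) * hom_enum (12 * m) B (1 + y) (\<i> * (1 - y))
      = hom_enum (12 * m) E ((1 + y) + (\<i> * (1 - y))) ((1 + y) - (\<i> * (1 - y)))"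
      unfolding mE ..
    \<comment> \<open>Factoring out 1 + i brings the arguments into the shape of
      \<open>hom_enum_shadow\<close> at -iy; the extra sign is absorbed by the even weights of
      \<open>E\<close>.\<close>
    also have "(1 + y) + (\<i> * (1 - y)) = (1 + \<i>) * (1 + (-\<i> * y))" by (simp add: algebra_simps)
    also have "(1 + y) - (\<i> * (1 - y)) = (1 + \<i>) * (- (\<i> * (1 - (-\<i> * y))))" by (simp add: algebra_simps)
    also have "hom_enum (12 * m) E ((1 + \<i>) * (1 + (-\<i> * y))) ((1 + \<i>) * (- (\<i> * (1 - (-\<i> * y)))))
       = (1 + \<i>) ^ (12 * m) * hom_enum (12 * m) E (1 + (-\<i> * y)) (- (\<i> * (1 - (-\<i> * y))))"
      by (rule hom_enum_homogeneous[OF BT(2) T])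
    also have "hom_enum (12 * m) E (1 + (-\<i> * y)) (- (\<i> * (1 - (-\<i> * y)))) = hom_enum (12 * m) E (1 + (-\<i> * y)) (\<i> * (1 - (-\<i> * y)))"
      unfolding hom_enum_def by (intro sum.cong refl) (simp add: evE)
    also have "\<dots> = of_nat (card E) * hom_enum (12 * m) S 1 (-\<i> * y)"
      unfolding S_def by (rule hom_enum_shadow[OF T E])
    finally have "of_nat (card E) * hom_enum (12 * m) B (1 + y) (\<i> * (1 - y))
       = of_nat (card E) * (2 ^ (6 * m) * (-1) ^ m * hom_enum (12 * m) S 1 (-\<i> * y))"
      unfolding one_plus_i_power by (simp only: mult_ac)
    moreover have "of_nat (card E) \<noteq> (0::complex)" using e by simp
    ultimately have eB: "hom_enum (12 * m) B (1 + y) (\<i> * (1 - y)) = 2 ^ (6 * m) * ((-1) ^ m * hom_enum (12 * m) S 1 (-\<i> * y))"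
      by (simp add: mult.assoc)
    have eE: "of_nat \<kappa> * hom_enum (12 * m) E (1 + y) (\<i> * (1 - y)) = 2 ^ (6 * m) * hom_enum (12 * m) S 1 y"
      unfolding hom_enum_shadow[OF T E] S_def \<kappa>E'[symmetric] by (simp only: mult_ac)
    have "(1 + y) ^ (12 * m) * poly p (\<i> * (1 - y) / (1 + y))
      = 2 ^ (6 * m) * ((-1) ^ m * hom_enum (12 * m) S 1 (-\<i> * y) - hom_enum (12 * m) S 1 y)"
      unfolding p_div[OF y1] eB eE by (simp add: algebra_simps)
    also have "(-1) ^ m * hom_enum (12 * m) S 1 (-\<i> * y) - hom_enum (12 * m) S 1 y
      = (\<Sum>v\<in>S. if odd (card v div 2 + m) then -2 * y ^ card v else 0)"
      unfolding hom_enum_def sum_distrib_left sum_subtractf[symmetric]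
    proof (intro sum.cong refl)
      fix v assume "v \<in> S"
      then obtain k where k: "card v = 2 * k" using evS by blast
      have "(-\<i> * y) ^ card v = (-1) ^ k * y ^ card v"
        unfolding k power_mult by (simp add: power_mult_distrib flip: power_minus)
      then have "(-1) ^ m * (1 ^ (12 * m - card v) * (-\<i> * y) ^ card v) = (-1) ^ (k + m) * y ^ card v"
        by (simp add: power_add)
      then show "(-1) ^ m * (1 ^ (12 * m - card v) * (-\<i> * y) ^ card v) - 1 ^ (12 * m - card v) * y ^ card v
         = (if odd (card v div 2 + m) then -2 * y ^ card v else 0)"
        by (auto simp: k uminus_power_if)
    qed
    also have "\<dots> = (\<Sum>v\<in>R. -2 * y ^ card v)"
      unfolding R_def using finS by (intro sum.inter_filter[symmetric])
    also have "\<dots> = -2 * poly (enum_poly R) y"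
      by (simp add: enum_poly_def poly_sum poly_monom sum_distrib_left)
    finally show ?thesis by simp
  qed

  \<comment> \<open>Here d = 2 and J = m. Words of \<open>R\<close> have weight congruent to 2m + 2,
    hence to h, modulo 4, so \<open>A\<close> is a nonnegative combination of their counts.\<close>
  define h where "h = 6 * m - 2"
  define A where "A = (\<Sum>l\<le>h div 4 - m. card {v \<in> R. card v = h mod 4 + 4 * l} * ((h div 4 - m - l + 2 * m) choose (2 * m)))"
  define G where "G = (if even m then chebyshev_coeff m (m div 2 + m) else 2 * ((m div 2 + 2 * m) choose (2 * m)))"
  have id1: "- (2 * 2 ^ (6 * m)) * (\<Sum>l\<le>h div 4 - m. coeff (enum_poly R) (h mod 4 + 4 * l) *
             fps_nth ((if (2::nat) = 0 then 1 + fX else 1) * inverse (1 - fX) ^ (2 * m + 1)) (h div 4 - m - l))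
       = (if (2::nat) = 0 then 1 else 8) * 4 ^ (h - 4 * m) * (-4) ^ m * coeff p 0 *
         fps_nth ((if (2::nat) = 0 then 1 - 6 * fX + fX^2 else 1) * inverse (1 + fX) ^ (h + 1 - 4 * m)
            * inverse (1 - fX) ^ (2 * m + 1)) m"
  proof (rule enumerator_identity[of "-1" "[:1,-6,1:]" 2 "6 * m" p])
    show "sign_factor (- 1) [:1, - 6, 1:] 2" by (simp add: sign_factor_def)
    show "2 \<le> 6 * m" "4 * m \<le> h" using m by (simp_all add: h_def)
  qed (use inv Q low in \<open>auto simp: h_def\<close>)
  have id2: "(\<Sum>l\<le>h div 4 - m. coeff (enum_poly R) (h mod 4 + 4 * l) *
             fps_nth ((if (2::nat) = 0 then 1 + fX else 1) * inverse (1 - fX) ^ (2 * m + 1)) (h div 4 - m - l)) = of_nat A"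
  proof -
    have "(if (2::nat) = 0 then 1 + fX else 1) = 1" by simp
    then show ?thesis unfolding A_def of_nat_sum of_nat_mult
      by (simp only: coeff_enum_poly[OF finR] fps_nth_inverse_one_minus_X_power mult_1_left)
  qed
  have id3: "h + 1 - 4 * m = 2 * m - 1" "h - 4 * m = 2 * (m - 1)" using m by (auto simp: h_def)
  have id4: "(if (2::nat) = 0 then 1 - 6 * fX + fX^2 else 1) = 1" "(if (2::nat) = 0 then 1 else 8) = (8::complex)" by simp_all
  have "- (2 * 2 ^ (6 * m)) * of_nat A = 8 * 4 ^ (2 * (m - 1)) * (-4) ^ m * (1 - of_nat \<kappa>) * (of_nat G :: complex)"
    using id1 unfolding id2 id3 id4 p0 mult_1_left shadow_lagrange_coeff[OF m] G_def .
  moreover have "8 * 4 ^ (2 * (m - 1)) * (-4) ^ m = (2 ^ (6 * m) * (-1) ^ m / 2 :: complex)"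
  proof -
    have "(2::complex) ^ (6 * m) = 4 ^ (3 * m)" unfolding power_mult by simp
    also have "3 * m = 2 * (m - 1) + 2 + m" using m by simp
    also have "(4::complex) ^ (2 * (m - 1) + 2 + m) = 4 ^ (2 * (m - 1)) * 16 * 4 ^ m" unfolding power_add by simp
    finally have "(2::complex) ^ (6 * m) = 4 ^ (2 * (m - 1)) * 16 * 4 ^ m" .
    moreover have "(-4 :: complex) ^ m = (-1) ^ m * 4 ^ m" by (simp flip: power_mult_distrib)
    ultimately show ?thesis by simp
  qed
  ultimately have "2 ^ (6 * m) * (- 4 * of_nat A) = 2 ^ (6 * m) * ((-1) ^ m * (1 - of_nat \<kappa>) * (of_nat G :: complex))"
  proof -
    have "u * (- 4 * a) = u * (s * t * g)" if "- (2 * u) * a = w * t * g" "w = u * s / 2" for u a w t g s :: complex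
      using that(1) unfolding that(2) by (simp add: field_simps)
    moreover assume "- (2 * 2 ^ (6 * m)) * of_nat A = 8 * 4 ^ (2 * (m - 1)) * (-4) ^ m * (1 - of_nat \<kappa>) * (of_nat G :: complex)"
      "8 * 4 ^ (2 * (m - 1)) * (-4) ^ m = (2 ^ (6 * m) * (-1) ^ m / 2 :: complex)"
    ultimately show ?thesis by blast
  qed
  then have AG: "- 4 * of_nat A = (-1) ^ m * (1 - of_nat \<kappa>) * (of_nat G :: complex)"
    unfolding mult_cancel_left by simp
  obtain k where k: "\<kappa> = Suc k" "odd k" using \<kappa> by (cases \<kappa>) auto
  show False
  proof (cases "even m")
    case False
    \<comment> \<open>For odd m the signs force a sum of nonnegative terms to vanish, although k and
      \<open>G\<close> are positive.\<close>
    then have "- (4 * of_nat A) = (of_nat k * of_nat G :: complex)"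
      using AG by (simp add: k(1))
    then have "of_nat (4 * A + k * G) = (0::complex)"
      unfolding of_nat_add of_nat_mult by (simp add: neg_eq_iff_add_eq_0)
    then have "4 * A + k * G = 0" unfolding of_nat_eq_0_iff .
    then have "k * G = 0" by simp
    moreover have "G > 0" using False by (simp add: G_def)
    ultimately show False using k by auto
  next
    case True
    then have "- (4 * of_nat A) = - (of_nat k * of_nat G :: complex)"
      using AG by (simp add: k(1))
    then have "of_nat (4 * A) = (of_nat (k * G) :: complex)" by simp
    then have A: "4 * A = k * G" unfolding of_nat_eq_iff .
    from par True obtain \<mu> where \<mu>: "m = 2 * \<mu>" "odd ((5 * \<mu> - 1) choose (\<mu> - 1))" by auto
    have "G = 6 * ((5 * \<mu> - 1) choose (\<mu> - 1))"
      using binomial_5_sum[of \<mu>] m by (simp add: G_def \<mu>(1))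
    \<comment> \<open>Halving leaves the even number 2A equal to a product of odd numbers.\<close>
    then have "2 * A = k * (3 * ((5 * \<mu> - 1) choose (\<mu> - 1)))" using A by simp
    then have "even (k * (3 * ((5 * \<mu> - 1) choose (\<mu> - 1))))" by (metis dvd_triv_left)
    then show False using \<mu>(2) k(2) unfolding even_mult_iff by simp
  qed
qed

subsection \<open>Freeness\<close>

lemma bit_add_self: "x + x = (0::bit)"
  by (cases x) simp_all

text \<open>In characteristic 2, a0 + a1 \<sigma> = (a0 + a1) + a1 (1 + \<sigma>), which separates a
  combination into a plain part and a norm part.\<close>

lemma bit_scale_add: "a0 * x + a1 * y = (if a0 \<noteq> a1 then x else 0) + (if a1 \<noteq> 0 then x + y else (0::bit))"
  by (cases a0; cases a1; cases x; cases y) simp_all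

lemma of_nat_bit_eq_0_iff: "of_nat k = (0::bit) \<longleftrightarrow> even k"
  by (induction k) auto

declare add_bit_eq_xor [simp del] mult_bit_eq_and [simp del]

lemma sum_bit_sym_diff:
  fixes f :: "'a \<Rightarrow> bit"
  assumes "finite A" "finite B"
  shows "sum f (sym_diff A B) = sum f A + sum f B"
proof -
  have "sum f A = sum f (A - B) + sum f (A \<inter> B)" 
    using assms by (subst sum.union_disjoint[symmetric]) (auto intro!: arg_cong[of _ _ "sum f"])
  moreover have "sum f B = sum f (B - A) + sum f (A \<inter> B)" 
    using assms by (subst sum.union_disjoint[symmetric]) (auto intro!: arg_cong[of _ _ "sum f"])
  moreover have "sum f (sym_diff A B) = sum f (A - B) + sum f (B - A)"
    using assms by (intro sum.union_disjoint) auto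
  moreover have "a + b = (a + c) + (b + c)" for a b c :: bit
    by (cases a; cases b; cases c) simp_all
  ultimately show ?thesis by metis
qed

lemma sum_in_code:
  fixes C :: "('i \<Rightarrow> bit) set"
  assumes "finite D" "D \<subseteq> C" "(\<lambda>_. 0) \<in> C" "\<And>x y. x \<in> C \<Longrightarrow> y \<in> C \<Longrightarrow> (\<lambda>i. x i + y i) \<in> C"
  shows "(\<lambda>i. \<Sum>b\<in>D. b i) \<in> C"
  using assms(1,2)
proof (induction D rule: finite_induct)
  case empty
  then show ?case using assms(3) by simp
next
  case (insert b D)
  then have "(\<lambda>i. b i + (\<Sum>b\<in>D. b i)) \<in> C" by (intro assms(4)) auto
  then show ?case using insert.hyps by (simp del: add_bit_eq_xor)
qed

text \<open>A basis is obtained from a family of smallest cardinality whose norms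
  \<open>b + \<sigma> b\<close> span all norms: minimality makes these norms independent.\<close>

lemma free_galg_module_if_fixed_norm:
  assumes fin: "finite C" and zero: "(\<lambda>_. 0) \<in> C"
    and add: "\<And>x y. x \<in> C \<Longrightarrow> y \<in> C \<Longrightarrow> (\<lambda>i. x i + y i) \<in> C"
    and inv: "\<And>x. perm_vec \<sigma> x = x \<circ> \<sigma>" "\<And>i. \<sigma> (\<sigma> i) = i"
    and fixed: "\<And>c. c \<in> C \<Longrightarrow> c \<circ> \<sigma> = c \<Longrightarrow> \<exists>d\<in>C. c = (\<lambda>i. d i + d (\<sigma> i))"
  shows "free_galg_module \<sigma> C"
proof -
  define L where "L D = (\<lambda>i. \<Sum>b\<in>D. b i + b (\<sigma> i))" for D :: "(nat \<Rightarrow> bit) set"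
  define spans where "spans B \<longleftrightarrow> B \<subseteq> C \<and> (\<forall>c\<in>C. \<exists>D\<subseteq>B. L D = (\<lambda>i. c i + c (\<sigma> i)))" for B
  have "spans C" unfolding spans_def
  proof (intro conjI ballI)
    fix c assume "c \<in> C"
    then show "\<exists>D\<subseteq>C. L D = (\<lambda>i. c i + c (\<sigma> i))"
      by (intro exI[of _ "{c}"]) (simp add: L_def)
  qed simp
  then obtain B where B: "spans B" and min: "\<And>B'. spans B' \<Longrightarrow> card B \<le> card B'"
    using ex_has_least_nat[of spans C card] by blast
  have BC: "B \<subseteq> C" using B by (simp add: spans_def)
  have finB: "finite B" using BC fin by (rule finite_subset)
  have finD: "finite D" if "D \<subseteq> B" for D using that finB by (rule finite_subset)
  have L_sd: "L (sym_diff D D') = (\<lambda>i. L D i + L D' i)" if "D \<subseteq> B" "D' \<subseteq> B" for D D'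
    unfolding L_def using that by (simp only: sum_bit_sym_diff[OF finD finD])
  have inj: "D = D'" if D: "D \<subseteq> B" "D' \<subseteq> B" "L D = L D'" for D D'
  proof (rule ccontr)
    assume "D \<noteq> D'"
    define Z where "Z = sym_diff D D'"
    have Z: "Z \<subseteq> B" "Z \<noteq> {}" using D \<open>D \<noteq> D'\<close> by (auto simp: Z_def)
    have LZ: "L Z = (\<lambda>_. 0)" unfolding Z_def using L_sd[OF D(1,2)] D(3) by (simp only: bit_add_self)
    from Z obtain z where z: "z \<in> Z" by blast
    \<comment> \<open>The norms of \<open>Z\<close> sum to zero, so adding \<open>Z\<close> to a
      family containing z removes z without changing the sum of norms.\<close>
    have "spans (B - {z})" unfolding spans_def
    proof (intro conjI ballI)
      show "B - {z} \<subseteq> C" using BC by blast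
      fix c assume "c \<in> C"
      then obtain D0 where D0: "D0 \<subseteq> B" "L D0 = (\<lambda>i. c i + c (\<sigma> i))" using B by (auto simp: spans_def)
      show "\<exists>D\<subseteq>B - {z}. L D = (\<lambda>i. c i + c (\<sigma> i))"
      proof (cases "z \<in> D0")
        case True
        have "L (sym_diff D0 Z) = L D0" unfolding L_sd[OF D0(1) Z(1)] LZ by simp
        moreover have "sym_diff D0 Z \<subseteq> B - {z}" using True z D0 Z by blast
        ultimately show ?thesis using D0(2) by metis
      next
        case False
        then show ?thesis using D0 by blast
      qed
    qed
    then have "card B \<le> card (B - {z})" by (rule min)
    then show False using z Z finB by (metis card_Diff1_less not_le subsetD)
  qed
  define S where "S D = (\<lambda>i. \<Sum>b\<in>D. b i)" for D :: "(nat \<Rightarrow> bit) set"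
  have comb: "(\<Sum>b\<in>B. galg_act \<sigma> (coef b) b i)
      = S {b \<in> B. fst (coef b) \<noteq> snd (coef b)} i + L {b \<in> B. snd (coef b) \<noteq> 0} i" for coef i
  proof -
    have "(\<Sum>b\<in>B. galg_act \<sigma> (coef b) b i)
      = (\<Sum>b\<in>B. (if fst (coef b) \<noteq> snd (coef b) then b i else 0) + (if snd (coef b) \<noteq> 0 then b i + b (\<sigma> i) else 0))"
      unfolding galg_act_def inv(1) comp_apply bit_scale_add ..
    also have "\<dots> = S {b \<in> B. fst (coef b) \<noteq> snd (coef b)} i + L {b \<in> B. snd (coef b) \<noteq> 0} i"
      unfolding S_def L_def sum.inter_filter[OF finB] by (rule sum.distrib)
    finally show ?thesis .
  qed
  have LS: "L D = (\<lambda>i. S D i + S D (\<sigma> i))" for D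
    unfolding L_def S_def by (simp only: sum.distrib)
  have Lfix: "L D (\<sigma> i) = L D i" for D i
    unfolding LS inv(2) by (rule add.commute)
  have uniq: "D1 = D1' \<and> D2 = D2'"
    if sub: "D1 \<subseteq> B" "D1' \<subseteq> B" "D2 \<subseteq> B" "D2' \<subseteq> B"
    and eq: "(\<lambda>i. S D1 i + L D2 i) = (\<lambda>i. S D1' i + L D2' i)" for D1 D1' D2 D2'
  proof -
    \<comment> \<open>Applying 1 + \<sigma> kills the norm part, which is fixed by \<sigma>. This
      determines the plain part, and then independence of norms determines the rest.\<close>
    have norm: "(S D i + L D' i) + (S D (\<sigma> i) + L D' (\<sigma> i)) = L D i" for D D' i
    proof -
      have "(a + c) + (b + c) = a + b" for a b c :: bit
        by (cases a; cases b; cases c) simp_all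
      then show ?thesis unfolding Lfix LS[of D] .
    qed
    have "L D1 i = L D1' i" for i
      using fun_cong[OF eq, of i] fun_cong[OF eq, of "\<sigma> i"] norm[of D1 i D2] norm[of D1' i D2'] by metis
    then have 1: "D1 = D1'" using sub by (intro inj ext)
    have "L D2 = L D2'"
    proof
      fix i
      show "L D2 i = L D2' i" using fun_cong[OF eq, of i] unfolding 1 by (simp only: add_left_cancel)
    qed
    then show ?thesis using 1 sub inj by blast
  qed
  have "\<exists>!coef. coef \<in> B \<rightarrow>\<^sub>E UNIV \<and> c = (\<lambda>i. \<Sum>b\<in>B. galg_act \<sigma> (coef b) b i)" if c: "c \<in> C" for c
  proof (rule ex_ex1I)
    obtain D1 where D1: "D1 \<subseteq> B" "L D1 = (\<lambda>i. c i + c (\<sigma> i))" using B c by (auto simp: spans_def)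
    \<comment> \<open>Subtracting a combination with the same norm as c leaves a fixed word; by
      \<open>fixed\<close> it is itself a norm, hence in the span of the norms of
      \<open>B\<close>.\<close>
    define c' where "c' = (\<lambda>i. c i + S D1 i)"
    have "S D1 \<in> C" unfolding S_def
      using D1(1) BC finD by (intro sum_in_code zero add) auto
    then have "c' \<in> C" unfolding c'_def using c by (intro add)
    have "c' \<circ> \<sigma> = c'"
    proof
      fix i
      have "S D1 i + S D1 (\<sigma> i) = c i + c (\<sigma> i)" using fun_cong[OF D1(2), of i] unfolding LS .
      moreover have "u + v = x + y \<Longrightarrow> y + v = x + u" for x y u v :: bit
        by (cases x; cases y; cases u; cases v) simp_all
      ultimately show "(c' \<circ> \<sigma>) i = c' i" unfolding c'_def comp_apply by metis
    qed
    then obtain d where d: "d \<in> C" "c' = (\<lambda>i. d i + d (\<sigma> i))" using fixed \<open>c' \<in> C\<close> by blast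
    obtain D2 where D2: "D2 \<subseteq> B" "L D2 = c'" using B d by (auto simp: spans_def)
    define coef where "coef = restrict (\<lambda>b. ((if b \<in> D1 then 1 else 0 :: bit) + (if b \<in> D2 then 1 else 0), if b \<in> D2 then 1 else 0 :: bit)) B"
    have "{b \<in> B. fst (coef b) \<noteq> snd (coef b)} = D1" "{b \<in> B. snd (coef b) \<noteq> 0} = D2"
      using D1 D2 by (auto simp: coef_def split: if_splits)
    then have "(\<Sum>b\<in>B. galg_act \<sigma> (coef b) b i) = S D1 i + c' i" for i
      unfolding comb D2(2)[symmetric] by simp
    moreover have "S D1 i + c' i = c i" for i
      unfolding c'_def by (cases "S D1 i"; cases "c i") simp_all
    ultimately have "c = (\<lambda>i. \<Sum>b\<in>B. galg_act \<sigma> (coef b) b i)" by simp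
    moreover have "coef \<in> B \<rightarrow>\<^sub>E UNIV" by (simp add: coef_def)
    ultimately show "\<exists>coef. coef \<in> B \<rightarrow>\<^sub>E UNIV \<and> c = (\<lambda>i. \<Sum>b\<in>B. galg_act \<sigma> (coef b) b i)" by blast
  next
    fix f g
    assume f: "f \<in> B \<rightarrow>\<^sub>E UNIV \<and> c = (\<lambda>i. \<Sum>b\<in>B. galg_act \<sigma> (f b) b i)"
      and g: "g \<in> B \<rightarrow>\<^sub>E UNIV \<and> c = (\<lambda>i. \<Sum>b\<in>B. galg_act \<sigma> (g b) b i)"
    have eq: "{b \<in> B. fst (f b) \<noteq> snd (f b)} = {b \<in> B. fst (g b) \<noteq> snd (g b)} \<and>
          {b \<in> B. snd (f b) \<noteq> 0} = {b \<in> B. snd (g b) \<noteq> 0}"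
      by (rule uniq) (use f g comb in auto)
    show "f = g"
    proof
      fix b
      show "f b = g b"
      proof (cases "b \<in> B")
        case True
        then have "fst (f b) \<noteq> snd (f b) \<longleftrightarrow> fst (g b) \<noteq> snd (g b)" "snd (f b) \<noteq> 0 \<longleftrightarrow> snd (g b) \<noteq> 0"
          using eq by blast+
        then show ?thesis
          by (cases "fst (f b)"; cases "snd (f b)"; cases "fst (g b)"; cases "snd (g b)") (auto simp: prod_eq_iff)
      next
        case False
        then show ?thesis using f g by (metis PiE_arb)
      qed
    qed
  qed
  then show ?thesis unfolding free_galg_module_def
    by (intro exI[of _ B] conjI ballI finB BC)
qed

section \<open>Vectors over the two-element field and their supports\<close>

lemma finite_vecs: "finite (vecs n)"
proof -
  have "vecs n \<subseteq> (\<lambda>A i. if i \<in> A then 1 else 0) ` Pow {..<n}"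
  proof
    fix x assume x: "x \<in> vecs n"
    have "x i = (if i \<in> {i. x i \<noteq> 0} then 1 else 0)" for i by simp
    then have "x = (\<lambda>i. if i \<in> {i. x i \<noteq> 0} then 1 else 0)" by blast
    moreover have "{i. x i \<noteq> 0} \<in> Pow {..<n}" using x by (auto simp: vecs_def not_le[symmetric])
    ultimately show "x \<in> (\<lambda>A i. if i \<in> A then 1 else 0) ` Pow {..<n}" by (rule image_eqI)
  qed
  then show ?thesis by (rule finite_subset) simp
qed

lemma inner_eq_0_iff: "inner n x y = 0 \<longleftrightarrow> even (card {i. i < n \<and> x i \<noteq> 0 \<and> y i \<noteq> 0})"
proof -
  have "inner n x y = (\<Sum>i<n. if x i \<noteq> 0 \<and> y i \<noteq> 0 then 1 else 0)"
    unfolding inner_def by (intro sum.cong) auto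
  also have "\<dots> = of_nat (card {i \<in> {..<n}. x i \<noteq> 0 \<and> y i \<noteq> 0})"
    by (subst sum.inter_filter[symmetric]) simp_all
  finally show ?thesis by (simp add: of_nat_bit_eq_0_iff)
qed

abbreviation supp :: "(nat \<Rightarrow> bit) \<Rightarrow> nat set" where
  "supp x \<equiv> {i. x i \<noteq> 0}"

lemma supp_vecs: "x \<in> vecs n \<Longrightarrow> supp x \<subseteq> {..<n}"
  by (auto simp: vecs_def not_le[symmetric])

lemma supp_add: "supp (\<lambda>i. x i + y i) = sym_diff (supp x) (supp y)"
proof -
  have "a + b \<noteq> 0 \<longleftrightarrow> (a \<noteq> 0) \<noteq> (b \<noteq> 0)" for a b :: bit
    by (cases a; cases b) simp_all
  then show ?thesis by auto
qed

lemma inner_supp: "x \<in> vecs n \<Longrightarrow> inner n x y = 0 \<longleftrightarrow> even (card (supp x \<inter> supp y))"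
  unfolding inner_eq_0_iff using supp_vecs[of x n]
  by (intro arg_cong[of _ _ "\<lambda>A. even (card A)"]) auto

lemma self_dual_supp:
  assumes "self_dual n C"
  shows "binary_code {..<n} (supp ` C)" "dual_sets {..<n} (supp ` C) = supp ` C"
proof -
  have C: "C \<subseteq> vecs n" "(\<lambda>_. 0) \<in> C" "\<And>x y. x \<in> C \<Longrightarrow> y \<in> C \<Longrightarrow> (\<lambda>i. x i + y i) \<in> C" "C = dual_code n C"
    using assms by (auto simp: self_dual_def linear_code_def)
  show "binary_code {..<n} (supp ` C)" unfolding binary_code_def
  proof (intro conjI ballI)
    show "supp ` C \<subseteq> Pow {..<n}" using C(1) supp_vecs by blast
    show "{} \<in> supp ` C" by (rule image_eqI[OF _ C(2)]) simp
    fix a b assume "a \<in> supp ` C" "b \<in> supp ` C"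
    then obtain x y where xy: "x \<in> C" "y \<in> C" "a = supp x" "b = supp y" by blast
    show "sym_diff a b \<in> supp ` C" unfolding xy supp_add[symmetric]
      by (rule imageI) (rule C(3)[OF xy(1,2)])
  qed
  show "dual_sets {..<n} (supp ` C) = supp ` C"
  proof (intro equalityI subsetI)
    fix v assume v: "v \<in> dual_sets {..<n} (supp ` C)"
    define x where "x = (\<lambda>i. if i \<in> v then 1 else 0 :: bit)"
    have sx: "supp x = v" by (auto simp: x_def)
    have "x \<in> vecs n" using v by (auto simp: x_def vecs_def dual_sets_def)
    moreover have "inner n c x = 0" if "c \<in> C" for c
    proof -
      have "even (card (v \<inter> supp c))" using v that by (auto simp: dual_sets_def)
      then show ?thesis using inner_supp[of c n x] that C(1) sx by (auto simp: Int_commute)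
    qed
    ultimately have "x \<in> dual_code n C" by (simp add: dual_code_def)
    then show "v \<in> supp ` C" using C(4) sx by blast
  next
    fix v assume "v \<in> supp ` C"
    then obtain x where x: "x \<in> C" "v = supp x" by blast
    show "v \<in> dual_sets {..<n} (supp ` C)" unfolding dual_sets_def
    proof (intro CollectI conjI ballI)
      show "v \<subseteq> {..<n}" using x C(1) supp_vecs by blast
      fix c assume "c \<in> supp ` C"
      then obtain y where y: "y \<in> C" "c = supp y" by blast
      have "x \<in> dual_code n C" using x C(4) by simp
      then have "inner n y x = 0" using y by (simp add: dual_code_def)
      then show "even (card (v \<inter> c))" using inner_supp[of y n x] x y C(1) by (auto simp: Int_commute)
    qed
  qed
qed

section \<open>Orbit representatives, fixed words and norms\<close>

theorem theorem1p1:
  fixes m :: nat and C :: "(nat \<Rightarrow> bit) set" and \<sigma> :: "nat \<Rightarrow> nat"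
  assumes "m \<ge> 1"
    and "extremal m C"
    and "is_aut (24 * m) C \<sigma>"
    and "\<sigma> \<circ> \<sigma> = id" and "\<sigma> \<noteq> id"
    and "\<forall>i < 24 * m. \<sigma> i \<noteq> i"
    and "odd m \<or> (\<exists>\<mu>. m = 2 * \<mu> \<and> odd ((5 * \<mu> - 1) choose (\<mu> - 1)))"
  shows "free_galg_module \<sigma> C"
proof -
  define n where "n = 24 * m"
  have sd: "self_dual n C" and md: "min_dist n C = 4 * m + 4"
    using assms(2) by (simp_all add: extremal_def n_def)
  have C: "C \<subseteq> vecs n" "(\<lambda>_. 0) \<in> C" "\<And>x y. x \<in> C \<Longrightarrow> y \<in> C \<Longrightarrow> (\<lambda>i. x i + y i) \<in> C"
    using sd by (auto simp: self_dual_def linear_code_def)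
  have Cdual: "x \<in> C" if "x \<in> vecs n" "\<And>c. c \<in> C \<Longrightarrow> inner n c x = 0" for x
    using sd that by (auto simp: self_dual_def dual_code_def)
  have finC: "finite C" using C(1) finite_vecs by (rule finite_subset)
  have \<sigma>\<sigma>: "\<sigma> (\<sigma> i) = i" for i using fun_cong[OF assms(4), of i] by simp
  have "inv \<sigma> = \<sigma>" using assms(4) by (metis inv_unique_comp)
  then have pv: "perm_vec \<sigma> x = x \<circ> \<sigma>" for x by (simp add: perm_vec_def)
  have perm: "\<sigma> permutes {0..<n}" and img: "perm_vec \<sigma> ` C = C"
    using assms(3) by (simp_all add: is_aut_def n_def)
  have C\<sigma>: "x \<circ> \<sigma> \<in> C" if "x \<in> C" for x using img that unfolding pv by blast
  have \<sigma>n: "\<sigma> i < n \<longleftrightarrow> i < n" for i using permutes_in_image[OF perm, of i] by simp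
  have weight: "4 * m + 4 \<le> card (supp x)" if "x \<in> C" "supp x \<noteq> {}" for x
  proof -
    have "weight n x = card (supp x)" unfolding weight_def
      using supp_vecs[of x n] that C(1) by (intro arg_cong[of _ _ card]) auto
    moreover have "x \<noteq> (\<lambda>_. 0)" using that by auto
    then have "min_dist n C \<le> weight n x" unfolding min_dist_def using finC that by (intro Min_le) auto
    ultimately show ?thesis using md by simp
  qed
  have doubly: "4 dvd card (supp x)" if "x \<in> C" for x
  proof (rule extremal_doubly_even[of "{..<n}" m "supp ` C"])
    show "4 * m + 4 \<le> card c" if "c \<in> supp ` C" "c \<noteq> {}" for c using weight that by blast
  qed (use self_dual_supp[OF sd] that assms(1) in \<open>auto simp: n_def\<close>)

  \<comment> \<open>The smaller point of each 2-cycle.\<close>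
  define T where "T = {i. i < n \<and> i < \<sigma> i}"
  have inj: "inj_on \<sigma> A" for A by (rule inj_on_inverseI[of _ \<sigma>]) (rule \<sigma>\<sigma>)
  have T_disj: "T \<inter> \<sigma> ` T = {}" by (auto simp: T_def \<sigma>\<sigma>)
  have T_cover: "i \<in> T \<or> \<sigma> i \<in> T" if "i < n" for i
  proof -
    have "\<sigma> i \<noteq> i" using assms(6) that by (simp add: n_def)
    then show ?thesis using that \<sigma>n[of i] by (auto simp: T_def \<sigma>\<sigma>)
  qed
  have T: "finite T" "T \<subseteq> {..<n}" by (auto simp: T_def)
  have "{..<n} = T \<union> \<sigma> ` T"
  proof (intro equalityI subsetI)
    fix i assume "i \<in> {..<n}"
    then show "i \<in> T \<union> \<sigma> ` T" using T_cover[of i] \<sigma>\<sigma>[of i] by (metis UnI1 UnI2 image_eqI lessThan_iff)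
  qed (auto simp: T_def \<sigma>n)
  then have "n = card T + card (\<sigma> ` T)" using card_Un_disjoint[OF T(1) finite_imageI[OF T(1)] T_disj]
    by (metis card_lessThan)
  then have cardT: "card T = 12 * m" using card_image[OF inj, of T] by (simp add: n_def)

  \<comment> \<open>\<open>lift\<close> turns subsets of \<open>T\<close> into \<sigma>-fixed
    vectors, and \<phi> records (1 + \<sigma>)c on the representatives.\<close>
  define lift where "lift v = (\<lambda>i. if i \<in> v \<or> \<sigma> i \<in> v then 1 else 0 :: bit)" for v
  define \<phi> where "\<phi> c = {i \<in> T. c i \<noteq> c (\<sigma> i)}" for c :: "nat \<Rightarrow> bit"
  have supp_lift: "supp (lift v) = v \<union> \<sigma> ` v" for v
  proof -
    have "\<sigma> i \<in> v \<longleftrightarrow> i \<in> \<sigma> ` v" for i using \<sigma>\<sigma> by (metis image_iff)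
    then show ?thesis by (auto simp: lift_def)
  qed
  have disj: "v \<inter> \<sigma> ` v = {}" "finite v" if "v \<subseteq> T" for v
    using that T_disj T(1) by (blast, auto intro: finite_subset)
  \<comment> \<open>The maps \<open>lift\<close> and \<phi> are adjoint: the orbit of i contributes
    c(i) + c(\<sigma> i) to the inner product.\<close>
  have lift_parity: "even (card (supp (lift v) \<inter> supp c)) \<longleftrightarrow> even (card (v \<inter> \<phi> c))" if v: "v \<subseteq> T" for v c
  proof -
    have "card (supp (lift v) \<inter> supp c) = card ((v \<inter> supp c) \<union> (\<sigma> ` v \<inter> supp c))"
      unfolding supp_lift by (rule arg_cong[of _ _ card]) blast
    also have "\<dots> = card (v \<inter> supp c) + card (\<sigma> ` v \<inter> supp c)"
      using disj[OF v] by (intro card_Un_disjoint) auto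
    also have "\<sigma> ` v \<inter> supp c = \<sigma> ` (v \<inter> supp (c \<circ> \<sigma>))" by auto
    also have "card (\<sigma> ` (v \<inter> supp (c \<circ> \<sigma>))) = card (v \<inter> supp (c \<circ> \<sigma>))" by (rule card_image[OF inj])
    finally have "even (card (supp (lift v) \<inter> supp c)) \<longleftrightarrow> even (card (v \<inter> sym_diff (supp c) (supp (c \<circ> \<sigma>))))"
      unfolding even_card_Int_sym_diff[OF disj(2)[OF v]] by simp
    also have "v \<inter> sym_diff (supp c) (supp (c \<circ> \<sigma>)) = v \<inter> \<phi> c"
    proof -
      have "(a \<noteq> 0) \<noteq> (b \<noteq> 0) \<longleftrightarrow> a \<noteq> b" for a b :: bit by (cases a; cases b) simp_all
      then show ?thesis using v by (auto simp: \<phi>_def)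
    qed
    finally show ?thesis .
  qed
  define E where "E = \<phi> ` C"
  have lift_vecs: "lift v \<in> vecs n" if "v \<subseteq> T" for v
    using that T(2) \<sigma>n unfolding lift_def vecs_def by (auto simp: not_less[symmetric])
  \<comment> \<open>By adjointness and self-duality of \<open>C\<close>, the dual of the norms is
    the fixed code.\<close>
  have dualE: "v \<in> dual_sets T E \<longleftrightarrow> v \<subseteq> T \<and> lift v \<in> C" for v
  proof (intro iffI conjI)
    assume v: "v \<in> dual_sets T E"
    then show vT: "v \<subseteq> T" by (simp add: dual_sets_def)
    show "lift v \<in> C"
    proof (rule Cdual[OF lift_vecs[OF vT]])
      fix c assume c: "c \<in> C"
      then have "even (card (v \<inter> \<phi> c))" using v by (simp add: dual_sets_def E_def)
      then show "inner n c (lift v) = 0"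
        using inner_supp[of c n "lift v"] lift_parity[OF vT, of c] c C(1) by (auto simp: Int_commute)
    qed
  next
    assume v: "v \<subseteq> T \<and> lift v \<in> C"
    have "even (card (v \<inter> \<phi> c))" if "c \<in> C" for c
    proof -
      have "lift v \<in> dual_code n C" using v sd by (simp add: self_dual_def)
      then have "inner n c (lift v) = 0" using that by (simp add: dual_code_def)
      then show ?thesis
        using inner_supp[of c n "lift v"] lift_parity[of v c] v that C(1) by (auto simp: Int_commute)
    qed
    then show "v \<in> dual_sets T E" using v by (auto simp: dual_sets_def E_def)
  qed
  have lift_\<phi>: "lift (\<phi> c) = (\<lambda>i. c i + c (\<sigma> i))" if "c \<in> C" for c
  proof
    fix i
    have ab: "a + b = (if a \<noteq> b then 1 else 0)" for a b :: bit by (cases a; cases b) simp_all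
    show "lift (\<phi> c) i = c i + c (\<sigma> i)"
    proof (cases "i < n")
      case True
      then have "i \<in> \<phi> c \<or> \<sigma> i \<in> \<phi> c \<longleftrightarrow> c i \<noteq> c (\<sigma> i)" using T_cover[OF True] by (auto simp: \<phi>_def \<sigma>\<sigma>)
      then show ?thesis by (simp add: lift_def ab)
    next
      case False
      then have "i \<notin> T" "\<sigma> i \<notin> T" using T(2) \<sigma>n[of i] by auto
      moreover have "c i = 0" "c (\<sigma> i) = 0" using False \<sigma>n[of i] that C(1) by (auto simp: vecs_def not_less)
      ultimately show ?thesis by (simp add: lift_def \<phi>_def)
    qed
  qed
  have "dual_sets T E = E"
  proof (rule even_dual_self_dual[OF T(1) cardT assms(1) _ _ _ _ assms(7)])
    show "binary_code T E" unfolding binary_code_def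
    proof (intro conjI ballI)
      show "E \<subseteq> Pow T" by (auto simp: E_def \<phi>_def)
      show "{} \<in> E" unfolding E_def by (rule image_eqI[OF _ C(2)]) (simp add: \<phi>_def)
      fix a b assume "a \<in> E" "b \<in> E"
      then obtain x y where xy: "x \<in> C" "y \<in> C" "a = \<phi> x" "b = \<phi> y" by (auto simp: E_def)
      have "u + v \<noteq> u' + v' \<longleftrightarrow> (u \<noteq> u') \<noteq> (v \<noteq> v')" for u v u' v' :: bit
        by (cases u; cases v; cases u'; cases v') simp_all
      then have "\<phi> (\<lambda>i. x i + y i) = sym_diff (\<phi> x) (\<phi> y)" unfolding \<phi>_def by auto
      then show "sym_diff a b \<in> E" unfolding xy E_def using C(3)[OF xy(1,2)] by (metis image_eqI)
    qed
    show "E \<subseteq> dual_sets T E"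
    proof
      fix v assume "v \<in> E"
      then obtain c where c: "c \<in> C" "v = \<phi> c" by (auto simp: E_def)
      have "(\<lambda>i. c i + c (\<sigma> i)) \<in> C" using C(3)[OF c(1) C\<sigma>[OF c(1)]] by simp
      then show "v \<in> dual_sets T E" unfolding dualE c(2) lift_\<phi>[OF c(1)] by (auto simp: \<phi>_def)
    qed
    \<comment> \<open>Lifting doubles weights, so the bound 4m + 4 becomes 2m + 2 and divisibility
      by 4 becomes evenness.\<close>
    have card_lift: "card (supp (lift b)) = 2 * card b" if "b \<subseteq> T" for b
      unfolding supp_lift using card_Un_disjoint[OF disj(2)[OF that] finite_imageI[OF disj(2)[OF that]] disj(1)[OF that]]
        card_image[OF inj, of b] by simp
    show "2 * m + 2 \<le> card b" if "b \<in> dual_sets T E" "b \<noteq> {}" for b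
    proof -
      have b: "b \<subseteq> T" "lift b \<in> C" using that dualE by auto
      have "supp (lift b) \<noteq> {}" unfolding supp_lift using that by blast
      then show ?thesis using weight[OF b(2)] card_lift[OF b(1)] by linarith
    qed
    show "even (card b)" if "b \<in> dual_sets T E" for b
    proof -
      have b: "b \<subseteq> T" "lift b \<in> C" using that dualE by auto
      then show ?thesis using doubly[OF b(2)] card_lift[OF b(1)] by (auto elim!: dvdE)
    qed
  qed
  note selfdual = this
  show ?thesis
  \<comment> \<open>Equality of \<open>E\<close> with its dual says that every fixed word of
    \<open>C\<close> is a norm.\<close>
  proof (rule free_galg_module_if_fixed_norm[OF finC C(2,3) pv \<sigma>\<sigma>])
    fix c assume c: "c \<in> C" "c \<circ> \<sigma> = c"
    then have c\<sigma>: "c (\<sigma> i) = c i" for i by (metis comp_apply)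
    have cl: "lift (T \<inter> supp c) = c"
    proof
      fix i
      show "lift (T \<inter> supp c) i = c i"
      proof (cases "i < n")
        case True
        then show ?thesis using T_cover[OF True] by (auto simp: lift_def c\<sigma>)
      next
        case False
        then have "i \<notin> T" "\<sigma> i \<notin> T" using T(2) \<sigma>n[of i] by auto
        moreover have "c i = 0" using False c C(1) by (auto simp: vecs_def not_less)
        ultimately show ?thesis by (simp add: lift_def)
      qed
    qed
    then have "T \<inter> supp c \<in> dual_sets T E" unfolding dualE using c by simp
    then obtain d where d: "d \<in> C" "T \<inter> supp c = \<phi> d" unfolding selfdual by (auto simp: E_def)
    then show "\<exists>d\<in>C. c = (\<lambda>i. d i + d (\<sigma> i))" using lift_\<phi>[OF d(1)] cl by metis
  qed
qed

end
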